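(* If $K\subset\hat{\mathbb{C}}$ is a compactum, then $S(x)=\overline{R_K}[x]$ for all $x\in K$.
   Context: For a compactum $K$ and $x\in K$, $S(x)$ is the set of all $y\in K$ for which there do NOT exist two disjoint open sets $U_x,U_y\subset K$ with $x\in U_x$, $y\in U_y$ such that $K\setminus(U_x\cup U_y)$ has at most finitely many components intersecting both $\partial U_x$ and $\partial U_y$. For disjoint simple closed curves $J_1,J_2\subset\hat{\mathbb{C}}$, $U(J_1,J_2)$ is the component of $\hat{\mathbb{C}}\setminus(J_1\cup J_2)$ with boundary $J_1\cup J_2$. The Schönflies relation $R_K$: $x\ne y$ satisfy $(x,y)\in R_K$ if there exist disjoint simple closed curves $J_1\ni x$, $J_2\ni y$ such that $\overline{U(J_1,J_2)}\cap K$ contains an infinite sequence of distinct components $P_n$ each meeting both $J_1$ and $J_2$ whose Hausdorff limit contains $\{x,y\}$. $\overline{R_K}$ is its closure in $K\times K$ and $\overline{R_K}[x]=\{y:(x,y)\in\overline{R_K}\}$. *)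

theory Defs
  imports "HOL-Analysis.Analysis"
begin

text \<open>The Riemann sphere is modelled as the unit sphere in Euclidean 3-space
  (homeomorphic to the one-point compactification of the complex plane).\<close>
definition Chat :: "(real^3) set" where
  "Chat = sphere 0 1"

definition simple_closed_curve :: "(real^3) set \<Rightarrow> bool" where
  "simple_closed_curve J \<longleftrightarrow> J \<subseteq> Chat \<and> J homeomorphic sphere (0::complex) 1"

definition S_set :: "(real^3) set \<Rightarrow> real^3 \<Rightarrow> (real^3) set" where
  "S_set K x = {y \<in> K. \<not> (\<exists>Ux Uy.
      openin (top_of_set K) Ux \<and> openin (top_of_set K) Uy \<and> Ux \<inter> Uy = {} \<and>
      x \<in> Ux \<and> y \<in> Uy \<and>
      finite {C \<in> components (K - (Ux \<union> Uy)).
                C \<inter> ((top_of_set K) frontier_of Ux) \<noteq> {} \<and>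
                C \<inter> ((top_of_set K) frontier_of Uy) \<noteq> {}})}"

definition hausdorff_converges :: "(nat \<Rightarrow> 'a::metric_space set) \<Rightarrow> 'a set \<Rightarrow> bool" where
  "hausdorff_converges P L \<longleftrightarrow>
     (\<forall>e>0. eventually (\<lambda>n. (\<forall>a\<in>P n. \<exists>b\<in>L. dist a b < e) \<and>
                               (\<forall>b\<in>L. \<exists>a\<in>P n. dist a b < e)) sequentially)"

definition schoenflies_rel :: "(real^3) set \<Rightarrow> ((real^3) \<times> (real^3)) set" where
  "schoenflies_rel K =
     {(x, x) | x :: real^3. x \<in> K} \<union>
     {(x, y) | (x :: real^3) (y :: real^3). x \<in> K \<and> y \<in> K \<and> x \<noteq> y \<and>
        (\<exists>J1 J2 U (P :: nat \<Rightarrow> (real^3) set) (L :: (real^3) set).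
           simple_closed_curve J1 \<and> simple_closed_curve J2 \<and> J1 \<inter> J2 = {} \<and>
           x \<in> J1 \<and> y \<in> J2 \<and>
           U \<in> components (Chat - (J1 \<union> J2)) \<and>
           (top_of_set Chat) frontier_of U = J1 \<union> J2 \<and>
           inj P \<and>
           (\<forall>n. P n \<in> components (closure U \<inter> K) \<and> P n \<inter> J1 \<noteq> {} \<and> P n \<inter> J2 \<noteq> {}) \<and>
           compact L \<and> hausdorff_converges P L \<and> {x, y} \<subseteq> L)}"

end

theory Submission
  imports Defs "HOL-Complex_Analysis.Great_Picard"
begin

text \<open>
  If y lies in S(x), take small round circles J1 and J2 about x and y. Infinitely many
  components of K between them cross from J1 to J2; a Hausdorff limit of these meets both circles,
  which puts points of the Schoenflies relation arbitrarily close to (x, y).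

  Conversely, let (x, y) be in the relation, with crossing continua P n accumulating at x and y inside
  the closed annulus A bounded by J1 and J2. If removing some neighbourhoods of x and y from K leaves
  only finitely many crossing components, the same holds for smaller neighbourhoods, which may
  therefore be chosen to meet J1 and J2 in arcs. If the resulting crossing
  pieces D n of the P n lay in only finitely many components, infinitely many D n would have to touch
  the same curve, say J1. Three of these together with the part of A near x, the
  neighbourhood of y, and the side of J1 away from A would form a planar drawing of the complete
  bipartite graph on 3 + 3 vertices. That this is impossible follows from Janiszewski's theorem and
  its dual. Local connectedness of A at x, which is needed to connect the D n near x, also
  comes from Janiszewski's theorem, so no Schoenflies theorem is required.
\<close>

section \<open>Three spokes in the plane\<close>

text \<open>The obstacle in the converse is that pieces which are distinct components within the
  annulus may be joined to each other outside it. A piece touching neither curve lies in the open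
  annulus, where nothing beyond can reach it, so it is already a component of the whole remaining
  set. Hence pieces that share a component must touch \<open>J1\<close> or \<open>J2\<close>. A
  piece touching \<open>J1\<close> has access there to the side of \<open>J1\<close> away from the
  annulus, and this is what makes that side the third hub. The link to the hub near x is more
  delicate: the piece meets only the closure of the neighbourhood \<open>V\<close>, and a contact on
  the curve itself would not allow a link that stays on the annulus side. Letting \<open>V\<close>
  cut an open arc out of the curve settles two things at once. Bad contacts can occur only at the
  end points of the arc, so disjoint pieces produce finitely many of them, and the rest of the curve
  is connected, which is the hypothesis of Janiszewski's theorem for local connectedness at
  x.\<close>

lemma not_connected_component_Int:
  fixes F G :: "'a::real_normed_vector set"
  assumes FG: "closed F" "closed G" and g: "g \<notin> F"
    and b: "\<not> connected_component (-F) g b"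
    and CF: "connected_component_set (-F) g \<inter> G = {}"
    and CG: "connected_component_set (-G) g \<inter> F = {}"
  shows "\<not> connected_component (-(F \<inter> G)) g b"
proof
  assume gb: "connected_component (-(F \<inter> G)) g b"
  define C where "C = connected_component_set (-F) g"
  have gC: "g \<in> C" using g by (simp add: C_def)
  then have gG: "g \<notin> G" using CF C_def by blast
  \<comment> \<open>Each of the two components is connected and misses the other closed set, so by
    maximality each contains the other.\<close>
  have eq: "connected_component_set (-G) g = C"
  proof
    show "C \<subseteq> connected_component_set (-G) g"
      using CF gC by (intro connected_component_maximal) (auto simp: C_def)
    show "connected_component_set (-G) g \<subseteq> C"
      unfolding C_def using CG gG by (intro connected_component_maximal) auto
  qed
  have *: "frontier (connected_component_set (- S) g) \<subseteq> S" if "closed S" "g \<notin> S" for S :: "'a set"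
  proof -
    have "connected_component_set (- S) g \<in> components (-S)"
      using that by (simp add: componentsI)
    then have "frontier (connected_component_set (- S) g) \<subseteq> frontier S"
      using frontier_of_components_subset frontier_complement by metis
    then show ?thesis using frontier_subset_closed that by blast
  qed
  \<comment> \<open>The common component has its frontier in both sets, so leaving it means hitting
    \<open>F \<inter> G\<close>.\<close>
  have fro: "frontier C \<subseteq> F \<inter> G"
    using *[OF FG(1) g] *[OF FG(2) gG] eq C_def by auto
  let ?X = "connected_component_set (-(F \<inter> G)) g"
  have "?X \<inter> frontier C \<noteq> {}"
  proof (rule connected_Int_frontier)
    have "g \<in> ?X" using g by simp
    then show "?X \<inter> C \<noteq> {}" using gC by blast
    show "?X - C \<noteq> {}" using gb b by (auto simp: C_def)
  qed simp
  then show False using fro connected_component_subset by fastforce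
qed

text \<open>
  The nonplanarity of the complete bipartite graph on 3 + 3 vertices for hubs T, B, I and spokes M i.
  Let b be a point of I. Two spokes together with T and B separate b from some g although neither does
  alone; adding the third spoke, which is joined to b, then forces the frontier of the component of g
  into T, B and a single spoke, which do not separate g from b.
\<close>
lemma three_spokes_contradiction:
  fixes T B I :: "complex set" and M :: "nat \<Rightarrow> complex set"
  assumes T: "compact T" "connected T" "T \<noteq> {}" and B: "compact B" "connected B" "B \<noteq> {}"
    and TB: "T \<inter> B = {}"
    and I: "connected I" "I \<noteq> {}" "bounded (-I)" "I \<inter> (T \<union> B) = {}"
    and M: "\<And>i. i < 3 \<Longrightarrow> M i \<noteq> {}"
           "\<And>i. i < 3 \<Longrightarrow> M i \<inter> (T \<union> B \<union> I) = {}"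
           "\<And>i. i < 3 \<Longrightarrow> compact (T \<union> B \<union> M i)"
           "\<And>i. i < 3 \<Longrightarrow> connected (M i \<union> T)"
           "\<And>i. i < 3 \<Longrightarrow> connected (M i \<union> B)"
           "\<And>i. i < 3 \<Longrightarrow> connected (M i \<union> I)"
    and MM: "\<And>i j. \<lbrakk>i < 3; j < 3; i \<noteq> j\<rbrakk> \<Longrightarrow> M i \<inter> M j = {}"
  shows False
proof -
  define A where "A i = T \<union> B \<union> M i" for i
  obtain b where b: "b \<in> I" using I by blast
  have Acl: "closed (A i)" and Acp: "compact (A i)" if "i < 3" for i
    using M(3)[OF that] compact_imp_closed by (auto simp: A_def)
  have Aconn: "connected (A i)" if "i < 3" for i
  proof -
    have "connected ((M i \<union> T) \<union> (M i \<union> B))"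
      by (rule connected_Un) (use M(1)[OF that] M(4,5) that in auto)
    then show ?thesis by (simp add: A_def Un_ac)
  qed
  have bA: "b \<notin> A i" if "i < 3" for i using b I M(2)[OF that] by (auto simp: A_def)
  \<comment> \<open>A spoke followed by the hub \<open>I\<close> leads to \<open>b\<close>; a set
    avoiding both cannot cut the points of the spoke off from \<open>b\<close>.\<close>
  have hub: "connected_component (-F) z b" if "i < 3" "z \<in> M i" "F \<inter> (M i \<union> I) = {}" for F z i
    using M(6)[OF that(1)] that b unfolding connected_component_def
    by (intro exI[of _ "M i \<union> I"]) auto
  have miss: "connected_component_set (-F) g \<inter> M i = {}"
    if "i < 3" "F \<inter> (M i \<union> I) = {}" "\<not> connected_component (-F) g b" for F g i
    using hub[OF that(1) _ that(2)] that(3) connected_component_trans by fastforce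
  have dis: "A j \<inter> (M i \<union> I) = {}" if "i < 3" "j < 3" "i \<noteq> j" for i j
    using M(2)[OF that(1)] M(2)[OF that(2)] MM[OF that] I(4) by (auto simp: A_def)
  have AA: "A i \<inter> A j = T \<union> B" if "i < 3" "j < 3" "i \<noteq> j" for i j
    using MM[OF that] by (auto simp: A_def)
  have ccT: "connected_component (-T) z b" if "z \<in> B" for z
  proof -
    have "connected ((M 0 \<union> B) \<union> (M 0 \<union> I))"
      by (rule connected_Un) (use M(1)[of 0] M(5,6) in auto)
    then show ?thesis
      unfolding connected_component_def
      using that b TB I(4) M(2)[of 0] by (intro exI[of _ "(M 0 \<union> B) \<union> (M 0 \<union> I)"]) auto
  qed
  have ccB: "connected_component (-B) z b" if "z \<in> T" for z
  proof -
    have "connected ((M 0 \<union> T) \<union> (M 0 \<union> I))"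
      by (rule connected_Un) (use M(1)[of 0] M(4,6) in auto)
    then show ?thesis
      unfolding connected_component_def
      using that b TB I(4) M(2)[of 0] by (intro exI[of _ "(M 0 \<union> T) \<union> (M 0 \<union> I)"]) auto
  qed
  \<comment> \<open>Without such a point, the dual of Janiszewski's theorem would make the
    intersection of two filled sets connected, although it splits into a part at \<open>T\<close>
    and a part at \<open>B\<close>.\<close>
  have "\<exists>g. connected_component (-A 0) g b \<and> connected_component (-A 1) g b
           \<and> \<not> connected_component (-(A 0 \<union> A 1)) g b"
  proof (rule ccontr)
    assume nog: "\<not> ?thesis"
    \<comment> \<open>For \<open>b\<close> outside \<open>F\<close>, this is \<open>F\<close> with
      every complementary region filled in except the one of \<open>b\<close>. Since the component
      of \<open>b\<close> contains \<open>I\<close>, the filling of \<open>A i\<close> is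
      bounded.\<close>
    define H where "H F = - connected_component_set (-F) b" for F
    have inH: "z \<in> H F \<longleftrightarrow> \<not> connected_component (-F) z b" for z F
      by (auto simp: H_def connected_component_sym_eq)
    have clH: "closed (H F)" if "closed F" for F
      unfolding H_def using that by (simp add: closed_Compl open_connected_component open_Compl)
    have Hcp: "compact (H (A i))" and Hconn: "connected (H (A i))" if "i < 3" for i
    proof -
      have "I \<subseteq> connected_component_set (- A i) b"
        using b I M(2)[OF that] by (intro connected_component_maximal) (auto simp: A_def)
      then have "bounded (H (A i))"
        unfolding H_def by (meson Compl_anti_mono I(3) bounded_subset)
      then show "compact (H (A i))" using clH Acl that compact_eq_bounded_closed by blast
      show "connected (H (A i))"
        unfolding H_def using Aconn bA that by (intro component_complement_connected[of "A i"]) (auto intro: componentsI)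
    qed
    \<comment> \<open>By \<open>nog\<close> no point is cut off from \<open>b\<close> by the union
      alone; hence the complement of the two fillings is a single component, as the dual theorem
      requires.\<close>
    have "- (H (A 0) \<union> H (A 1)) = connected_component_set (-(A 0 \<union> A 1)) b"
    proof (intro equalityI subsetI)
      fix z assume "z \<in> - (H (A 0) \<union> H (A 1))"
      then show "z \<in> connected_component_set (-(A 0 \<union> A 1)) b"
        using nog inH by (auto simp: connected_component_sym_eq)
    next
      fix z assume "z \<in> connected_component_set (-(A 0 \<union> A 1)) b"
      then have "connected_component (-(A 0 \<union> A 1)) z b" by (simp add: connected_component_sym_eq)
      then show "z \<in> - (H (A 0) \<union> H (A 1))"
        using inH connected_component_of_subset[of "-(A 0 \<union> A 1)" z b "-A 0"]
              connected_component_of_subset[of "-(A 0 \<union> A 1)" z b "-A 1"] by auto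
    qed
    then have "connected (H (A 0) \<inter> H (A 1))"
      using Hcp Hconn by (intro Janiszewski_dual) auto
    \<comment> \<open>A point off \<open>T \<union> B\<close> cut off by both \<open>A 0\<close> and
      \<open>A 1\<close> is cut off by their intersection \<open>T \<union> B\<close>. As
      \<open>T\<close> and \<open>B\<close> have empty, hence connected, intersection, Janiszewski's
      theorem shows that one of them separates alone.\<close>
    moreover have sub: "H (A 0) \<inter> H (A 1) \<subseteq> H T \<union> H B"
    proof
      fix g assume g: "g \<in> H (A 0) \<inter> H (A 1)"
      then have n: "\<not> connected_component (-A 0) g b" "\<not> connected_component (-A 1) g b"
        using inH by auto
      show "g \<in> H T \<union> H B"
      proof (cases "g \<in> T \<union> B")
        case True
        then show ?thesis unfolding Un_iff inH using connected_component_in by fastforce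
      next
        case False
        have "g \<notin> M 0" using hub[of 0 g "A 1"] n dis[of 0 1] by auto
        moreover have "g \<notin> M 1" using hub[of 1 g "A 0"] n dis[of 1 0] by auto
        ultimately have "g \<notin> A 0" using False by (auto simp: A_def)
        have e: "connected_component_set (- A i) g \<inter> A j = {}"
          if "i \<noteq> j" "i < 2" "j < 2" for i j
        proof -
          have "connected_component_set (- A i) g \<inter> M j = {}"
            using miss[of j "A i" g] dis[of j i] n that by (auto simp: less_2_cases_iff)
          moreover have "connected_component_set (- A i) g \<subseteq> - A i"
            by (rule connected_component_subset)
          ultimately show ?thesis by (auto simp: A_def)
        qed
        have "\<not> connected_component (-(A 0 \<inter> A 1)) g b"
          using Acl e[of 0 1] e[of 1 0] n \<open>g \<notin> A 0\<close> by (intro not_connected_component_Int) auto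
        moreover have "A 0 \<inter> A 1 = T \<union> B" using AA[of 0 1] by simp
        ultimately have "\<not> connected_component (-(T \<union> B)) g b" by metis
        then have "\<not> (connected_component (-T) g b \<and> connected_component (-B) g b)"
          using Janiszewski[OF T(1) compact_imp_closed[OF B(1)]] TB by fastforce
        then show ?thesis using inH by auto
      qed
    qed
    \<comment> \<open>A point cut off by both \<open>T\<close> and \<open>B\<close> would be cut off
      by \<open>T \<inter> B\<close>, which is empty.\<close>
    moreover have "H T \<inter> H B = {}"
    proof (rule ccontr)
      assume "H T \<inter> H B \<noteq> {}"
      then obtain g where n: "\<not> connected_component (-T) g b" "\<not> connected_component (-B) g b"
        using inH by auto
      have gT: "g \<notin> T" using ccB n by auto
      have 1: "connected_component_set (-T) g \<inter> B = {}"
        using ccT n connected_component_trans by fastforce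
      have 2: "connected_component_set (-B) g \<inter> T = {}"
        using ccB n connected_component_trans by fastforce
      have "\<not> connected_component (-(T \<inter> B)) g b"
        using T B 1 2 n gT by (intro not_connected_component_Int) (auto intro: compact_imp_closed)
      then show False using TB
        by (metis Compl_empty_eq connected_UNIV connected_iff_connected_component iso_tuple_UNIV_I)
    qed
    moreover have "T \<union> B \<subseteq> H (A 0) \<inter> H (A 1)" 
      unfolding H_def using connected_component_subset[of "-A 0" b] connected_component_subset[of "-A 1" b]
      by (auto simp: A_def)
    moreover have "T \<subseteq> H T" "B \<subseteq> H B"
      unfolding H_def using connected_component_subset[of "-T" b] connected_component_subset[of "-B" b] by auto
    moreover have "closed (H T)" "closed (H B)" using clH T B by (auto intro: compact_imp_closed)
    moreover have "T \<inter> (H (A 0) \<inter> H (A 1)) \<noteq> {}" "B \<inter> (H (A 0) \<inter> H (A 1)) \<noteq> {}"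
      using calculation(4) T B by blast+
    ultimately show False
      using connected_closedD[of "H (A 0) \<inter> H (A 1)" "H T" "H B"] by blast
  qed
  then obtain g where g: "connected_component (-A 0) g b" "connected_component (-A 1) g b"
         and ng: "\<not> connected_component (-(A 0 \<union> A 1)) g b" by blast
  \<comment> \<open>Here \<open>A k \<union> A j\<close> separates \<open>g\<close> from
    \<open>b\<close>. If \<open>A k \<union> A 2\<close> did so too, then so would their
    intersection \<open>A k\<close>, against the choice of \<open>g\<close>.\<close>
  have key: False if k: "k < 2" "j < 2" "k \<noteq> j" and nk: "\<not> connected_component (-(A k \<union> A 2)) g b" for k j
  proof -
    have A01: "A 0 \<union> A 1 = A k \<union> A j" using k by (auto simp: less_2_cases_iff)
    have ng': "\<not> connected_component (-(A k \<union> A j)) g b" using ng A01 by metis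
    have gA: "g \<notin> A k \<union> A j" using g k connected_component_in by (fastforce simp: less_2_cases_iff)
    have k3: "k < 3" "j < 3" "k \<noteq> 2" "j \<noteq> 2" using k by auto
    have "connected_component_set (-(A k \<union> A j)) g \<inter> M 2 = {}"
      using ng' dis[of 2 k] dis[of 2 j] k3 by (intro miss) auto
    then have 1: "connected_component_set (-(A k \<union> A j)) g \<inter> (A k \<union> A 2) = {}"
      using connected_component_subset[of "-(A k \<union> A j)" g] by (auto simp: A_def)
    have "connected_component_set (-(A k \<union> A 2)) g \<inter> M j = {}"
      using nk dis[of j k] dis[of j 2] k3 k by (intro miss) auto
    then have 2: "connected_component_set (-(A k \<union> A 2)) g \<inter> (A k \<union> A j) = {}"
      using connected_component_subset[of "-(A k \<union> A 2)" g] by (auto simp: A_def)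
    have "\<not> connected_component (-((A k \<union> A j) \<inter> (A k \<union> A 2))) g b"
      using Acl 1 2 nk ng' gA k3 by (intro not_connected_component_Int) auto
    moreover have "(A k \<union> A j) \<inter> (A k \<union> A 2) = A k" using AA[of j 2] k3 by (auto simp: A_def)
    ultimately have "\<not> connected_component (- A k) g b" by metis
    moreover have "k = 0 \<or> k = 1" using k by auto
    ultimately show False using g by metis
  qed
  have "connected_component (-(A 0 \<union> A 2)) g b" "connected_component (-(A 1 \<union> A 2)) g b"
    using key[of 0 1] key[of 1 0] by auto
  \<comment> \<open>The overlap is connected, so Janiszewski's theorem combines the two failures to
    separate into one for the union, which contains \<open>A 0 \<union> A 1\<close>.\<close>
  moreover have "(A 0 \<union> A 2) \<inter> (A 1 \<union> A 2) = A 2" using AA[of 0 1] by (auto simp: A_def)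
  ultimately have "connected_component (-((A 0 \<union> A 2) \<union> (A 1 \<union> A 2))) g b"
    using Acp Acl Aconn by (intro Janiszewski[of "A 0 \<union> A 2" "A 1 \<union> A 2"]) auto
  then show False using ng connected_component_of_subset[of _ g b "-(A 0 \<union> A 1)"] by blast
qed

text \<open>The segment from \<open>z\<close> towards \<open>t\<close> is stopped just short of its
  first point in \<open>S\<close>. Omitting that end point makes the link disjoint from the hub, yet
  link and hub together stay compact and connected, the form that
  \<open>three_spokes_contradiction\<close> asks for.\<close>

lemma segment_to_compact:
  fixes S :: "'a::real_normed_vector set"
  assumes S: "compact S" "t \<in> S" "z \<notin> S"
  obtains e where "connected e" "z \<in> e" "e \<subseteq> closed_segment t z" "e \<inter> S = {}"
    "compact (S \<union> e)" "connected S \<Longrightarrow> connected (e \<union> S)"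
proof -
  define f where "f u = z + u *\<^sub>R (t - z)" for u
  have cf: "continuous_on X f" for X unfolding f_def by (intro continuous_intros)
  let ?P = "{0..1} \<inter> f -` S"
  have "compact ?P"
    using cf S(1) by (intro compact_Int_closed) (auto intro!: closed_vimage simp: compact_imp_closed continuous_on_eq_continuous_within)
  moreover have "1 \<in> ?P" using S by (simp add: f_def)
  ultimately obtain u where u: "u \<in> ?P" and min: "\<And>v. v \<in> ?P \<Longrightarrow> u \<le> v"
    using compact_attains_inf[of ?P] by blast
  have "u \<noteq> 0" using u S by (auto simp: f_def)
  then have u0: "0 < u" "u \<le> 1" "f u \<in> S" using u by auto
  have "f u = (1 - u) *\<^sub>R z + u *\<^sub>R t" for u by (simp add: f_def algebra_simps)
  then have seg: "f ` {0..1} = closed_segment t z"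
    unfolding closed_segment_commute[of t z] by (auto simp: closed_segment_def)
  have eq: "S \<union> f ` {0..<u} = S \<union> f ` {0..u}"
    using u0 by (auto simp: le_less)
  show ?thesis
  proof
    show "connected (f ` {0..<u})" by (intro connected_continuous_image cf) simp
    show "z \<in> f ` {0..<u}" using u0 by (intro image_eqI[of _ _ 0]) (auto simp: f_def)
    show "f ` {0..<u} \<subseteq> closed_segment t z" unfolding seg[symmetric] using u0 by auto
    show "f ` {0..<u} \<inter> S = {}" using min u0 by fastforce
    show "compact (S \<union> f ` {0..<u})"
      unfolding eq using S cf by (intro compact_Un compact_continuous_image) auto
    show "connected (f ` {0..<u} \<union> S)" if "connected S"
    proof -
      have "connected (S \<union> f ` {0..u})"
        using that u0 by (intro connected_Un connected_continuous_image cf) auto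
      then show ?thesis using eq by (simp add: Un_commute)
    qed
  qed
qed

lemma three_points_continuum:
  fixes S :: "'a::real_normed_vector set"
  assumes "open S" "connected S" "\<And>i. i < (3::nat) \<Longrightarrow> t i \<in> S"
  obtains K where "compact K" "connected K" "K \<subseteq> S" "\<And>i. i < 3 \<Longrightarrow> t i \<in> K"
proof -
  have pc: "path_connected S" using assms connected_open_path_connected by blast
  have t: "t 0 \<in> S" "t 1 \<in> S" "t 2 \<in> S" using assms(3) by auto
  obtain p where p: "path p" "path_image p \<subseteq> S" "pathstart p = t 0" "pathfinish p = t 1"
    using pc t unfolding path_connected_def by metis
  obtain q where q: "path q" "path_image q \<subseteq> S" "pathstart q = t 0" "pathfinish q = t 2"
    using pc t unfolding path_connected_def by metis
  have t: "t 0 \<in> path_image p" "t 1 \<in> path_image p" "t 0 \<in> path_image q" "t 2 \<in> path_image q"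
    using p q by (metis pathstart_in_path_image pathfinish_in_path_image)+
  show ?thesis
  proof
    show "compact (path_image p \<union> path_image q)" using p q by (simp add: compact_Un compact_path_image)
    show "connected (path_image p \<union> path_image q)"
      using t p q by (intro connected_Un connected_path_image) auto
    show "path_image p \<union> path_image q \<subseteq> S" using p q by auto
    show "t i \<in> path_image p \<union> path_image q" if "i < 3" for i
    proof -
      have "i = 0 \<or> i = 1 \<or> i = 2" using that by auto
      then show ?thesis using t by auto
    qed
  qed
qed

text \<open>Two points of \<open>V \<inter> inside J\<close> are separated neither by
  \<open>J\<close> nor by the complement of \<open>V\<close>. These two obstacles overlap in
  \<open>J - V\<close>, so connectedness of \<open>J - V\<close> is what Janiszewski's theorem
  needs.\<close>

lemma connected_Int_inside:
  fixes c :: "real \<Rightarrow> complex"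
  defines "J \<equiv> path_image c"
  assumes c: "simple_path c" "pathfinish c = pathstart c"
    and V: "open V" "connected V" "connected (J - V)"
  shows "connected (V \<inter> inside J)"
  unfolding connected_iff_connected_component
proof (intro ballI)
  note Jord = Jordan_inside_outside[OF c, folded J_def]
  fix a b assume ab: "a \<in> V \<inter> inside J" "b \<in> V \<inter> inside J"
  have "connected_component (- (J \<union> - V)) a b"
  proof (rule Janiszewski)
    show "compact J" using c J_def compact_simple_path_image by blast
    show "closed (- V)" using V by auto
    show "connected (J \<inter> - V)" using V by (simp add: Diff_eq)
    show "connected_component (- J) a b"
      unfolding connected_component_def using Jord ab inside_no_overlap[of J] by (intro exI[of _ "inside J"]) blast
    show "connected_component (- (- V)) a b"
      unfolding connected_component_def using V ab by (intro exI[of _ V]) auto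
  qed
  then obtain X where X: "connected X" "X \<subseteq> V - J" "a \<in> X" "b \<in> X"
    unfolding connected_component_def by auto
  have "X \<subseteq> inside J"
    using connected_Int_frontier[of X "inside J"] X ab Jord by blast
  then show "connected_component (V \<inter> inside J) a b"
    unfolding connected_component_def using X by blast
qed

text \<open>The hubs are a continuum in \<open>V \<inter> inside J\<close>, a continuum in
  \<open>W\<close>, and the outside of \<open>J\<close>; the spokes are the \<open>D i\<close>
  prolonged by short links. Contact with \<open>V\<close> is required off \<open>J\<close> so that
  its link can be kept inside \<open>J\<close>, whereas the outside is reached at a point of
  \<open>J\<close>.\<close>

lemma planar_three_continua:
  fixes c :: "real \<Rightarrow> complex" and D :: "nat \<Rightarrow> complex set"
  defines "J \<equiv> path_image c"
  assumes c: "simple_path c" "pathfinish c = pathstart c"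
    and V: "open V" "connected V" "connected (J - V)"
    and W: "open W" "connected W" "closure W \<inter> J = {}" "closure V \<inter> closure W = {}"
    and D: "\<And>i. i < 3 \<Longrightarrow> compact (D i)" "\<And>i. i < 3 \<Longrightarrow> connected (D i)"
      "\<And>i. i < 3 \<Longrightarrow> D i \<subseteq> J \<union> inside J" "\<And>i. i < 3 \<Longrightarrow> D i \<inter> (V \<union> W) = {}"
      "\<And>i. i < 3 \<Longrightarrow> closure V \<inter> D i - J \<noteq> {}" "\<And>i. i < 3 \<Longrightarrow> closure W \<inter> D i \<noteq> {}"
      "\<And>i. i < 3 \<Longrightarrow> D i \<inter> J \<noteq> {}"
    and DD: "\<And>i j. \<lbrakk>i < 3; j < 3; i \<noteq> j\<rbrakk> \<Longrightarrow> D i \<inter> D j = {}"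
  shows False
proof -
  have Ji: "open (inside J)" "connected (inside J)" "bounded (inside J)" "frontier (inside J) = J"
    and Jo: "connected (outside J)" "outside J \<noteq> {}" "frontier (outside J) = J"
    using Jordan_inside_outside[OF c, folded J_def] by blast+
  define T0 where "T0 = V \<inter> inside J"
  have T0: "open T0" "connected T0"
    using connected_Int_inside[OF c V[unfolded J_def]] V Ji by (auto simp: T0_def J_def)
  \<comment> \<open>Open Voronoi cells of the three continua: they are disjoint, so links confined
    to their own cells cannot meet another spoke.\<close>
  define G where "G i = (\<Inter>j\<in>{..<3}-{i}. {p. infdist p (D i) < infdist p (D j)})" for i :: nat
  have openG: "open (G i)" for i
    unfolding G_def by (intro open_INT ballI open_Collect_less continuous_intros) auto
  have GG: "G i \<inter> G j = {}" if "i < 3" "j < 3" "i \<noteq> j" for i j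
  proof -
    have "G i \<subseteq> {p. infdist p (D i) < infdist p (D j)}" "G j \<subseteq> {p. infdist p (D j) < infdist p (D i)}"
      using that by (auto simp: G_def)
    then show ?thesis by fastforce
  qed
  have DG: "D i \<subseteq> G i" if "i < 3" for i
  proof
    fix p assume p: "p \<in> D i"
    have "0 < infdist p (D j)" if "j < 3" "j \<noteq> i" for j
    proof -
      have "p \<notin> D j" using DD[of i j] \<open>i < 3\<close> that p by auto
      then show ?thesis
        using D(1)[of j] D(6)[of j] that
        by (metis compact_imp_closed in_closed_iff_infdist_zero infdist_nonneg inf_bot_right order_less_le)
    qed
    then show "p \<in> G i" using p by (auto simp: G_def)
  qed
  have "\<forall>i. \<exists>z. i < 3 \<longrightarrow> z \<in> closure V \<inter> D i - J" using D(5) by blast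
  then obtain z where z: "\<And>i. i < 3 \<Longrightarrow> z i \<in> closure V \<inter> D i - J" by metis
  have "\<forall>i. \<exists>y. i < 3 \<longrightarrow> y \<in> closure W \<inter> D i" using D(6) by blast
  then obtain y where y: "\<And>i. i < 3 \<Longrightarrow> y i \<in> closure W \<inter> D i" by metis
  have zin: "z i \<in> inside J" if "i < 3" for i using z D(3) that by fastforce
  have yin: "y i \<in> inside J" if "i < 3" for i using y D(3) W(3) that by fastforce
  have WJ: "W \<inter> J = {}" using W(3) closure_subset by blast
  have "W \<inter> inside J \<noteq> {}"
    using y[of 0] yin[of 0] Ji by (metis Int_iff closure_iff_nhds_not_empty disjoint_iff inf_commute zero_less_numeral order_refl)
  then have Win: "W \<subseteq> inside J"
    using connected_Int_frontier[of W "inside J"] W Ji WJ by auto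
  have zcl: "z i \<in> closure T0" if "i < 3" for i
  proof -
    have "inside J \<inter> closure V \<subseteq> closure (inside J \<inter> V)"
      using Ji by (intro open_Int_closure_subset) auto
    then show ?thesis using z[OF that] zin[OF that] by (auto simp: T0_def Int_commute)
  qed
  \<comment> \<open>Balls this small are convex, so straight links in them stay in their own cell,
    inside \<open>J\<close>, and clear of the opposite hub.\<close>
  have "\<forall>i. \<exists>r. i < 3 \<longrightarrow> r > 0 \<and> ball (z i) r \<subseteq> G i \<inter> inside J - closure W"
  proof (intro allI)
    fix i
    have "open (G i \<inter> inside J - closure W)" using openG Ji by (intro open_Diff open_Int) auto
    moreover have "z i \<in> G i \<inter> inside J - closure W" if "i < 3"
      using z[OF that] zin[OF that] DG[OF that] W by blast
    ultimately show "\<exists>r. i < 3 \<longrightarrow> r > 0 \<and> ball (z i) r \<subseteq> G i \<inter> inside J - closure W"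
      by (metis open_contains_ball)
  qed
  then obtain r where r: "\<And>i. i < 3 \<Longrightarrow> r i > 0"
       "\<And>i. i < 3 \<Longrightarrow> ball (z i) (r i) \<subseteq> G i \<inter> inside J - closure W" by metis
  have "\<forall>i. \<exists>r. i < 3 \<longrightarrow> r > 0 \<and> ball (y i) r \<subseteq> G i \<inter> inside J - closure V"
  proof (intro allI)
    fix i
    have "open (G i \<inter> inside J - closure V)" using openG Ji by (intro open_Diff open_Int) auto
    moreover have "y i \<in> G i \<inter> inside J - closure V" if "i < 3"
      using y[OF that] yin[OF that] DG[OF that] W by blast
    ultimately show "\<exists>r. i < 3 \<longrightarrow> r > 0 \<and> ball (y i) r \<subseteq> G i \<inter> inside J - closure V"
      by (metis open_contains_ball)
  qed
  then obtain s where s: "\<And>i. i < 3 \<Longrightarrow> s i > 0"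
       "\<And>i. i < 3 \<Longrightarrow> ball (y i) (s i) \<subseteq> G i \<inter> inside J - closure V" by metis
  have "\<forall>i. \<exists>t. i < 3 \<longrightarrow> t \<in> T0 \<inter> ball (z i) (r i)"
    using zcl r(1) unfolding closure_approachable by (auto simp: dist_commute) blast
  then obtain t where t: "\<And>i. i < 3 \<Longrightarrow> t i \<in> T0 \<inter> ball (z i) (r i)" by metis
  have "\<forall>i. \<exists>w. i < 3 \<longrightarrow> w \<in> W \<inter> ball (y i) (s i)"
    using y s(1) unfolding closure_approachable Int_iff by (auto simp: dist_commute) blast
  then obtain w where w: "\<And>i. i < 3 \<Longrightarrow> w i \<in> W \<inter> ball (y i) (s i)" by metis
  \<comment> \<open>Hubs have to be compact, so \<open>T0\<close> and \<open>W\<close> are replaced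
    by continua through the three points at which the links are aimed.\<close>
  obtain T where T: "compact T" "connected T" "T \<subseteq> T0" "\<And>i. i < 3 \<Longrightarrow> t i \<in> T"
    using three_points_continuum[OF T0] t by (metis IntD1)
  obtain B where B: "compact B" "connected B" "B \<subseteq> W" "\<And>i. i < 3 \<Longrightarrow> w i \<in> B"
    using three_points_continuum[OF W(1,2)] w by (metis IntD1)
  have clV: "T \<subseteq> closure V" "T \<subseteq> V" and clW: "B \<subseteq> closure W"
    using T B T0_def closure_subset by blast+
  have "\<forall>i. \<exists>e. i < 3 \<longrightarrow> connected e \<and> z i \<in> e \<and> e \<subseteq> closed_segment (t i) (z i) \<and> e \<inter> T = {}
          \<and> compact (T \<union> e) \<and> connected (e \<union> T)"
  proof (intro allI)
    fix i
    have "z i \<notin> T" if "i < 3" using z clV D(4) that by blast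
    then show "\<exists>e. i < 3 \<longrightarrow> connected e \<and> z i \<in> e \<and> e \<subseteq> closed_segment (t i) (z i) \<and> e \<inter> T = {}
          \<and> compact (T \<union> e) \<and> connected (e \<union> T)"
      using segment_to_compact[OF T(1) T(4)] T(2) by metis
  qed
  from choice[OF this] obtain e where E: "\<forall>i. i < 3 \<longrightarrow> connected (e i) \<and> z i \<in> e i \<and>
          e i \<subseteq> closed_segment (t i) (z i) \<and> e i \<inter> T = {}
          \<and> compact (T \<union> e i) \<and> connected (e i \<union> T)" ..
  then have e: "\<And>i. i < 3 \<Longrightarrow> connected (e i)" "\<And>i. i < 3 \<Longrightarrow> z i \<in> e i"
     "\<And>i. i < 3 \<Longrightarrow> e i \<subseteq> closed_segment (t i) (z i)" "\<And>i. i < 3 \<Longrightarrow> e i \<inter> T = {}"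
     "\<And>i. i < 3 \<Longrightarrow> compact (T \<union> e i)" "\<And>i. i < 3 \<Longrightarrow> connected (e i \<union> T)"
    by simp_all
  have "\<forall>i. \<exists>e. i < 3 \<longrightarrow> connected e \<and> y i \<in> e \<and> e \<subseteq> closed_segment (w i) (y i) \<and> e \<inter> B = {}
          \<and> compact (B \<union> e) \<and> connected (e \<union> B)"
  proof (intro allI)
    fix i
    have "y i \<notin> B" if "i < 3" using y B D(4) that by blast
    then show "\<exists>e. i < 3 \<longrightarrow> connected e \<and> y i \<in> e \<and> e \<subseteq> closed_segment (w i) (y i) \<and> e \<inter> B = {}
          \<and> compact (B \<union> e) \<and> connected (e \<union> B)"
      using segment_to_compact[OF B(1) B(4)] B(2) by metis
  qed
  from choice[OF this] obtain f where E: "\<forall>i. i < 3 \<longrightarrow> connected (f i) \<and> y i \<in> f i \<and>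
          f i \<subseteq> closed_segment (w i) (y i) \<and> f i \<inter> B = {}
          \<and> compact (B \<union> f i) \<and> connected (f i \<union> B)" ..
  then have f: "\<And>i. i < 3 \<Longrightarrow> connected (f i)" "\<And>i. i < 3 \<Longrightarrow> y i \<in> f i"
     "\<And>i. i < 3 \<Longrightarrow> f i \<subseteq> closed_segment (w i) (y i)" "\<And>i. i < 3 \<Longrightarrow> f i \<inter> B = {}"
     "\<And>i. i < 3 \<Longrightarrow> compact (B \<union> f i)" "\<And>i. i < 3 \<Longrightarrow> connected (f i \<union> B)"
    by simp_all
  have eball: "e i \<subseteq> G i \<inter> inside J - closure W" if "i < 3" for i
  proof -
    have "closed_segment (t i) (z i) \<subseteq> ball (z i) (r i)"
      using t[OF that] r(1)[OF that] by (intro closed_segment_subset) auto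
    then show ?thesis using e(3)[OF that] r(2)[OF that] by blast
  qed
  have fball: "f i \<subseteq> G i \<inter> inside J - closure V" if "i < 3" for i
  proof -
    have "closed_segment (w i) (y i) \<subseteq> ball (y i) (s i)"
      using w[OF that] s(1)[OF that] by (intro closed_segment_subset) auto
    then show ?thesis using f(3)[OF that] s(2)[OF that] by blast
  qed
  define M where "M i = e i \<union> D i \<union> f i" for i
  have MG: "M i \<subseteq> G i" if "i < 3" for i
    using eball[OF that] fball[OF that] DG[OF that] by (auto simp: M_def)
  have ed: "connected (e i \<union> D i)" "connected (f i \<union> D i)" "connected (M i)" if "i < 3" for i
  proof -
    show "connected (e i \<union> D i)" 
      using z[OF that] e(1,2)[OF that] D(2)[OF that] by (intro connected_Un) auto
    show 1: "connected (f i \<union> D i)" 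
      using y[OF that] f(1,2)[OF that] D(2)[OF that] by (intro connected_Un) auto
    have "connected (e i \<union> (f i \<union> D i))"
      using z[OF that] e(1,2)[OF that] 1 by (intro connected_Un[of "e i" "f i \<union> D i"]) auto
    then show "connected (M i)" by (simp add: M_def Un_ac)
  qed
  show False
  proof (rule three_spokes_contradiction[of T B "outside J" M])
    show "compact T" "connected T" "compact B" "connected B" by fact+
    show "T \<noteq> {}" "B \<noteq> {}" using T(4)[of 0] B(4)[of 0] by auto
    show "T \<inter> B = {}" using clV clW W(4) by auto
    show "connected (outside J)" "outside J \<noteq> {}" by fact+
    have "- outside J = J \<union> inside J" by (auto simp: outside_inside)
    then show "bounded (- outside J)" 
      using Ji c compact_imp_bounded[OF compact_simple_path_image] by (auto simp: J_def)
    show "outside J \<inter> (T \<union> B) = {}" using T(3) T0_def Win B(3) inside_Int_outside by blast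
    show "M i \<inter> M j = {}" if "i < 3" "j < 3" "i \<noteq> j" for i j
      using MG[OF that(1)] MG[OF that(2)] GG[OF that] by blast
    fix i :: nat assume i: "i < 3"
    show "M i \<noteq> {}" using z[OF i] by (auto simp: M_def)
    have "M i \<inter> T = {}" using e(4)[OF i] D(4)[OF i] fball[OF i] clV by (auto simp: M_def)
    moreover have "M i \<inter> B = {}" using f(4)[OF i] D(4)[OF i] eball[OF i] clW B(3) by (auto simp: M_def)
    moreover have "M i \<inter> outside J = {}"
      using fball[OF i] eball[OF i] D(3)[OF i] unfolding M_def outside_inside by blast
    ultimately show "M i \<inter> (T \<union> B \<union> outside J) = {}" by blast
    have "compact ((T \<union> e i) \<union> (B \<union> f i) \<union> D i)"
      using compact_Un[OF compact_Un[OF e(5) f(5)] D(1)] i by blast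
    then show "compact (T \<union> B \<union> M i)" by (simp add: M_def Un_ac)
    have "connected ((e i \<union> T) \<union> (M i))"
      using e(6)[OF i] e(2)[OF i] ed[OF i] z[OF i] by (intro connected_Un[of "e i \<union> T" "M i"]) (auto simp: M_def)
    then show "connected (M i \<union> T)" by (simp add: M_def Un_ac)
    have "connected ((f i \<union> B) \<union> (M i))"
      using f(6)[OF i] f(2)[OF i] ed[OF i] y[OF i] by (intro connected_Un[of "f i \<union> B" "M i"]) (auto simp: M_def)
    then show "connected (M i \<union> B)" by (simp add: M_def Un_ac)
    obtain p where p: "p \<in> D i" "p \<in> J" using D(7)[OF i] by auto
    \<comment> \<open>Adding a frontier point keeps the outside connected, and \<open>p\<close>
      already belongs to the spoke; so the third hub is reached without any link.\<close>
    have pcl: "p \<in> closure (outside J)" using p Jo(3) by (metis DiffD1 frontier_def)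
    have "outside J \<union> {p} \<subseteq> closure (outside J)"
      using pcl closure_subset by (metis Un_subset_iff empty_subsetI insert_subset)
    then have "connected (outside J \<union> {p})"
      by (rule connected_intermediate_closure[OF Jo(1) Un_upper1])
    then have "connected (M i \<union> (outside J \<union> {p}))"
      using ed(3)[OF i] p by (intro connected_Un[of "M i" "outside J \<union> {p}"]) (auto simp: M_def)
    then show "connected (M i \<union> outside J)" using p by (simp add: M_def insert_absorb)
  qed
qed

section \<open>Curves on the sphere\<close>

lemma punctured_Chat_homeomorphism:
  assumes "q \<in> Chat"
  obtains f g where "homeomorphism (Chat - {q}) (UNIV :: complex set) f g"
proof -
  let ?H = "{x :: real^3. axis 1 1 \<bullet> x = 0}"
  have "(sphere 0 1 - {q}) homeomorphic ?H"
    using assms by (intro homeomorphic_punctured_sphere_hyperplane) (auto simp: Chat_def axis_eq_0_iff)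
  moreover have "?H homeomorphic (UNIV :: complex set)"
    by (subst homeomorphic_subspaces_eq)
      (auto simp: subspace_hyperplane dim_hyperplane axis_eq_0_iff)
  ultimately have "(Chat - {q}) homeomorphic (UNIV :: complex set)"
    unfolding Chat_def using homeomorphic_trans by blast
  then show ?thesis using that unfolding homeomorphic_def by blast
qed

lemma simple_closed_curve_path:
  assumes J: "simple_closed_curve J" and x: "x \<in> J"
  obtains c where "simple_path c" "pathfinish c = pathstart c" "path_image c = J" "c (1/2) = x"
proof -
  obtain h k where hk: "homeomorphism (sphere (0::complex) 1) J h k"
    using J homeomorphic_sym unfolding simple_closed_curve_def homeomorphic_def by blast
  define d where "d = h \<circ> circlepath 0 1"
  have d: "simple_path d" unfolding d_def
    using hk by (intro simple_path_continuous_image)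
      (auto simp: simple_path_circlepath homeomorphism_def intro: inj_on_inverseI[of _ k])
  have dl: "pathfinish d = pathstart d" by (simp add: d_def pathfinish_compose pathstart_compose)
  have dJ: "path_image d = J" using hk by (simp add: d_def path_image_compose homeomorphism_def)
  obtain u where u: "0 \<le> u" "u \<le> 1" "d u = x" using x dJ by (auto simp: path_image_def)
  \<comment> \<open>The rotation brings the parameter of \<open>x\<close> to 1/2, away from the
    place where the loop closes. For \<open>u = 0\<close> it arrives at parameter 1 of
    \<open>d\<close>, which has the same value.\<close>
  define v where "v = (if u \<ge> 1/2 then u - 1/2 else u + 1/2)"
  have v: "v \<in> {0..1}" using u by (auto simp: v_def)
  have "d 0 = d 1" using dl by (simp add: pathfinish_def pathstart_def)
  then have "shiftpath v d (1/2) = x"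
    using u by (cases "u = 0") (auto simp: shiftpath_def v_def)
  then show ?thesis
    using that[of "shiftpath v d"] d dl dJ v
    by (simp add: simple_path_shiftpath path_image_shiftpath pathfinish_shiftpath pathstart_shiftpath)
qed

lemma simple_closed_curve_nonempty: "simple_closed_curve J \<Longrightarrow> J \<noteq> {}"
  unfolding simple_closed_curve_def using homeomorphic_empty by fastforce

lemma simple_closed_curve_compact: "simple_closed_curve J \<Longrightarrow> compact J"
  unfolding simple_closed_curve_def using homeomorphic_compactness compact_sphere by blast

lemma openin_Chat_image:
  assumes "homeomorphism (Chat - {q}) (UNIV :: complex set) f g" "openin (top_of_set Chat) V" "q \<notin> V"
  shows "open (f ` V)"
proof -
  have "openin (top_of_set (Chat - {q})) V"
    using assms(2,3) openin_imp_subset by (metis Diff_subset openin_subset_trans subset_Diff_insert Diff_empty)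
  then show ?thesis
    using homeomorphism_imp_open_map[OF assms(1)] by fastforce
qed

lemma open_image_Chat:
  assumes "homeomorphism (Chat - {q}) (UNIV :: complex set) f g" "open W"
  shows "openin (top_of_set Chat) (g ` W)"
proof -
  have "openin (top_of_set (Chat - {q})) (g ` W)"
    using homeomorphism_imp_open_map[OF homeomorphism_symD[OF assms(1)], of W] assms(2) by simp
  moreover have "openin (top_of_set Chat) (Chat - {q})" by (intro openin_delete openin_subtopology_self)
  ultimately show ?thesis using openin_trans by blast
qed

lemma planar_image_of_curve:
  assumes J: "simple_closed_curve J" and hom: "homeomorphism (Chat - {q}) (UNIV :: complex set) f g"
    and q: "q \<notin> J"
  obtains c where "simple_path c" "pathfinish c = pathstart c" "path_image c = f ` J"
proof -
  obtain x where "x \<in> J" using simple_closed_curve_nonempty J by blast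
  then obtain d where d: "simple_path d" "pathfinish d = pathstart d" "path_image d = J"
    using simple_closed_curve_path[OF J] by metis
  have sub: "J \<subseteq> Chat - {q}" using J q by (auto simp: simple_closed_curve_def)
  have "simple_path (f \<circ> d)"
  proof (rule simple_path_continuous_image[OF d(1)])
    show "continuous_on (path_image d) f"
      using hom sub d continuous_on_subset unfolding homeomorphism_def by blast
    show "inj_on f (path_image d)"
      using hom sub d by (intro inj_on_inverseI[of _ g]) (auto simp: homeomorphism_def)
  qed
  then show ?thesis using that[of "f \<circ> d"] d
    by (simp add: pathfinish_compose pathstart_compose path_image_compose)
qed

text \<open>This supplies the pole of the chart in \<open>sphere_three_continua\<close>. With the
  plane punctured at a point \<open>q\<close> of \<open>R\<close>, the inside of the image of
  \<open>J\<close> pulls back to a set whose trace on \<open>R\<close> is open, and also closed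
  because adding \<open>J\<close> makes it compact. As \<open>q\<close> is not in it,
  \<open>R\<close> cannot enter it at all.\<close>

lemma curve_two_sides:
  assumes J: "simple_closed_curve J" and R: "R \<in> components (Chat - J)"
  obtains p where "p \<in> Chat - J" "p \<notin> R"
proof -
  obtain q where q: "q \<in> R" using in_components_nonempty[OF R] by blast
  have RC: "R \<subseteq> Chat - J" "connected R" using R in_components_subset in_components_connected by auto
  obtain f g where hom: "homeomorphism (Chat - {q}) (UNIV :: complex set) f g"
    using punctured_Chat_homeomorphism q RC by blast
  obtain c where c: "simple_path c" "pathfinish c = pathstart c" "path_image c = f ` J"
    using planar_image_of_curve[OF J hom] q RC by blast
  let ?In = "inside (f ` J)"
  have Ji: "open ?In" "bounded ?In" "?In \<noteq> {}" "frontier ?In = f ` J"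
    using Jordan_inside_outside[OF c(1,2), unfolded c(3)] by blast+
  have JC: "J \<subseteq> Chat - {q}" using J q RC by (auto simp: simple_closed_curve_def)
  have "(\<lambda>x. g (f x)) ` J = (\<lambda>x. x) ` J"
    by (intro image_cong refl homeomorphism_apply1[OF hom]) (use JC in blast)
  then have gf: "g ` f ` J = J" by (simp add: image_image)
  have gU: "g ` UNIV = Chat - {q}" using hom by (simp add: homeomorphism_def)
  have "?In \<union> f ` J = closure ?In" using Ji(1,4) by (simp add: closure_Un_frontier)
  then have "compact (?In \<union> f ` J)" using Ji(2) by simp
  then have "compact (g ` (?In \<union> f ` J))"
    using hom by (intro compact_continuous_image) (auto simp: homeomorphism_def elim: continuous_on_subset)
  then have cl: "closed (g ` ?In \<union> J)" using gf by (simp add: image_Un compact_imp_closed)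
  have op: "openin (top_of_set Chat) (g ` ?In)" using open_image_Chat[OF hom Ji(1)] .
  obtain w where w: "w \<in> ?In" using Ji by blast
  have disj: "g ` ?In \<inter> J = {}"
  proof -
    have "inj g" using hom by (metis homeomorphism_def inj_on_inverseI)
    then have "g ` ?In \<inter> g ` f ` J = g ` (?In \<inter> f ` J)" by (simp only: image_Int)
    then have "g ` ?In \<inter> g ` f ` J = {}" by (simp only: inside_no_overlap image_empty)
    then show ?thesis using gf by simp
  qed
  have "g w \<notin> R"
  proof
    assume gw: "g w \<in> R"
    have "Chat \<inter> g ` ?In = g ` ?In" using openin_imp_subset[OF op] by blast
    then have "openin (top_of_set Chat) (Chat \<inter> g ` ?In)" using op by simp
    then have "openin (top_of_set R) (R \<inter> g ` ?In)"
      by (rule openin_subtopology_Int_subset) (use RC in blast)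
    moreover have "R \<inter> g ` ?In = R \<inter> (g ` ?In \<union> J)" using RC by auto
    then have "closedin (top_of_set R) (R \<inter> g ` ?In)" using cl by (metis closedin_closed_Int)
    ultimately have "R \<inter> g ` ?In = {} \<or> R \<inter> g ` ?In = R"
      using connected_clopen[THEN iffD1, OF RC(2), rule_format, of "R \<inter> g ` ?In"] by blast
    then show False using gw w q gU by blast
  qed
  moreover have "g w \<in> Chat - J" using gU disj w by blast
  ultimately show ?thesis using that by blast
qed

text \<open>The pole \<open>q\<close> is taken across \<open>J\<close> from \<open>R\<close>, so
  that the chart carries \<open>R\<close> to the bounded side of the image curve, where the planar
  lemma applies.\<close>

lemma sphere_three_continua:
  fixes D :: "nat \<Rightarrow> (real^3) set"
  assumes J: "simple_closed_curve J" and R: "R \<in> components (Chat - J)"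
    and q: "q \<in> Chat - J" "q \<notin> R" "q \<notin> closure V" "q \<notin> closure W"
    and V: "openin (top_of_set Chat) V" "connected V" "connected (J - V)"
    and W: "openin (top_of_set Chat) W" "connected W" "closure W \<inter> J = {}" "closure V \<inter> closure W = {}"
    and D: "\<And>i. i < 3 \<Longrightarrow> compact (D i)" "\<And>i. i < 3 \<Longrightarrow> connected (D i)"
      "\<And>i. i < 3 \<Longrightarrow> D i \<subseteq> J \<union> R" "\<And>i. i < 3 \<Longrightarrow> D i \<inter> (V \<union> W) = {}"
      "\<And>i. i < 3 \<Longrightarrow> closure V \<inter> D i - J \<noteq> {}" "\<And>i. i < 3 \<Longrightarrow> closure W \<inter> D i \<noteq> {}"
      "\<And>i. i < 3 \<Longrightarrow> D i \<inter> J \<noteq> {}"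
    and DD: "\<And>i j. \<lbrakk>i < 3; j < 3; i \<noteq> j\<rbrakk> \<Longrightarrow> D i \<inter> D j = {}"
  shows False
proof -
  have RC: "R \<subseteq> Chat - J" "connected R" using R in_components_subset in_components_connected by auto
  obtain f g where hom: "homeomorphism (Chat - {q}) (UNIV :: complex set) f g"
    using punctured_Chat_homeomorphism q by blast
  obtain c where c: "simple_path c" "pathfinish c = pathstart c" "path_image c = f ` J"
    using planar_image_of_curve[OF J hom] q by blast
  have Ji: "open (inside (f ` J))" "frontier (inside (f ` J)) = f ` J" 
    and Jo: "open (outside (f ` J))" "connected (outside (f ` J))" "\<not> bounded (outside (f ` J))"
       "frontier (outside (f ` J)) = f ` J" 
    using Jordan_inside_outside[OF c(1,2), unfolded c(3)] by blast+
  have JC: "J \<subseteq> Chat - {q}" using J q by (auto simp: simple_closed_curve_def)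
  have contf: "continuous_on (Chat - {q}) f" and contg: "continuous_on UNIV g"
    and gf: "\<And>x. x \<in> Chat - {q} \<Longrightarrow> g (f x) = x" and fg: "\<And>z. f (g z) = z"
    and gC: "\<And>z. g z \<in> Chat - {q}"
    using hom by (auto simp: homeomorphism_def)
  have injf: "inj_on f (Chat - {q})" using gf by (metis inj_on_inverseI)
  have clC: "closure V \<subseteq> Chat - {q}" "closure W \<subseteq> Chat - {q}"
  proof -
    have "closed Chat" by (simp add: Chat_def)
    then show "closure V \<subseteq> Chat - {q}" "closure W \<subseteq> Chat - {q}"
      using closure_minimal[of _ Chat] openin_imp_subset[OF V(1)] openin_imp_subset[OF W(1)] q by blast+
  qed
  have cpC: "compact Chat" by (simp add: Chat_def)
  \<comment> \<open>A closure that avoids the pole is compact, so the chart commutes with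
    it.\<close>
  have fcl: "f ` closure S = closure (f ` S)" if "closure S \<subseteq> Chat - {q}" for S
  proof
    have cf: "continuous_on (closure S) f" using contf that continuous_on_subset by blast
    then show "f ` closure S \<subseteq> closure (f ` S)" by (intro image_closure_subset) (auto simp: closure_subset)
    have "bounded S" using that cpC by (meson Diff_subset bounded_subset closure_subset compact_imp_bounded)
    then have "compact (f ` closure S)" using cf by (intro compact_continuous_image) auto
    then show "closure (f ` S) \<subseteq> f ` closure S"
      by (intro closure_minimal compact_imp_closed) (auto simp: closure_subset image_mono)
  qed
  have DC: "D i \<subseteq> Chat - {q}" if "i < 3" for i using D(3)[OF that] JC RC q by blast
  have VC: "V \<subseteq> Chat - {q}" "W \<subseteq> Chat - {q}" using clC closure_subset by blast+
  have im: "f ` S \<inter> f ` S' = f ` (S \<inter> S')" if "S \<subseteq> Chat - {q}" "S' \<subseteq> Chat - {q}" for S S'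
    using inj_on_image_Int[OF injf that] by simp
  have fR: "f ` R \<subseteq> inside (f ` J)"
  proof -
    have RCq: "R \<subseteq> Chat - {q}" using RC q by blast
    have cR: "connected (f ` R)"
      using RC(2) contf RCq by (meson connected_continuous_image continuous_on_subset)
    have dR: "f ` R \<inter> f ` J = {}" using im[OF RCq JC] RC by auto
    \<comment> \<open>The unbounded side accumulates at \<open>q\<close> when pulled back. With
      \<open>q\<close> added it is a connected set off \<open>J\<close>, so meeting \<open>R\<close>
      would place it, and \<open>q\<close>, in \<open>R\<close>.\<close>
    have "f ` R \<inter> outside (f ` J) = {}"
    proof (rule ccontr)
      assume ne: "f ` R \<inter> outside (f ` J) \<noteq> {}"
      let ?Y = "g ` outside (f ` J)"
      have "q \<in> closure ?Y"
      proof (rule ccontr)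
        assume "q \<notin> closure ?Y"
        moreover have "closure ?Y \<subseteq> Chat"
          using gC cpC by (intro closure_minimal) (auto intro: compact_imp_closed)
        ultimately have sub: "closure ?Y \<subseteq> Chat - {q}" by blast
        then have "bounded ?Y" by (meson Diff_subset bounded_subset closure_subset compact_imp_bounded cpC)
        then have "compact (f ` closure ?Y)"
          using contf sub by (intro compact_continuous_image) (auto elim: continuous_on_subset)
        moreover have "outside (f ` J) \<subseteq> f ` closure ?Y"
          using closure_subset[of ?Y] fg by (metis (no_types, opaque_lifting) image_subset_iff subsetD imageI subsetI)
        ultimately show False using Jo(3) bounded_subset compact_imp_bounded by blast
      qed
      moreover have "connected ?Y"
        using Jo(2) contg by (meson connected_continuous_image continuous_on_subset subset_UNIV)
      ultimately have cY: "connected (insert q ?Y)"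
        using connected_intermediate_closure[of ?Y "insert q ?Y"] closure_subset[of ?Y] by blast
      obtain w where w: "w \<in> R" "f w \<in> outside (f ` J)" using ne by blast
      have "w \<in> ?Y" using w gf RCq by (metis image_eqI subsetD)
      moreover have "?Y \<inter> J = {}"
      proof (rule ccontr)
        assume "?Y \<inter> J \<noteq> {}"
        then obtain z where "z \<in> outside (f ` J)" "g z \<in> J" by blast
        then show False using fg outside_no_overlap[of "f ` J"] by (metis disjoint_iff image_eqI)
      qed
      ultimately have "insert q ?Y \<subseteq> R"
        using cY gC q w by (intro components_maximal[OF R]) auto
      then show False using q by blast
    qed
    then show ?thesis using dR by (auto simp: outside_inside)
  qed
  show False
  proof (rule planar_three_continua[OF c(1,2), unfolded c(3)])
    show "open (f ` V)" "open (f ` W)" using openin_Chat_image[OF hom V(1)] openin_Chat_image[OF hom W(1)] VC by blast+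
    show "connected (f ` V)" "connected (f ` W)"
      using connected_continuous_image[OF continuous_on_subset[OF contf VC(1)] V(2)]
        connected_continuous_image[OF continuous_on_subset[OF contf VC(2)] W(2)] by blast+
    have "f ` J - f ` V = f ` (J - V)" using inj_on_image_set_diff[OF injf] JC VC by auto
    moreover have "J - V \<subseteq> Chat - {q}" using JC by blast
    ultimately show "connected (f ` J - f ` V)"
      using connected_continuous_image[OF continuous_on_subset[OF contf] V(3)] by simp
    show "closure (f ` W) \<inter> f ` J = {}" using im[OF clC(2) JC] fcl clC W(3) by simp
    show "closure (f ` V) \<inter> closure (f ` W) = {}" using im[OF clC] fcl clC W(4) by simp
    show "f ` D i \<inter> f ` D j = {}" if "i < 3" "j < 3" "i \<noteq> j" for i j
      using im DC DD that by simp
    fix i :: nat assume i: "i < 3"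
    have cD: "continuous_on (D i) f" using contf DC[OF i] continuous_on_subset by blast
    show "compact (f ` D i)" "connected (f ` D i)"
      using D(1,2)[OF i] cD by (auto intro: compact_continuous_image connected_continuous_image)
    show "f ` D i \<subseteq> f ` J \<union> inside (f ` J)" using D(3)[OF i] fR by blast
    show "f ` D i \<inter> (f ` V \<union> f ` W) = {}"
      using im[OF DC[OF i], of "V \<union> W"] VC D(4)[OF i] by (simp add: image_Un)
    obtain z where "z \<in> closure V" "z \<in> D i" "z \<notin> J" using D(5)[OF i] by blast
    moreover then have "f z \<notin> f ` J" using injf JC DC[OF i] by (meson inj_on_image_mem_iff subsetD)
    ultimately show "closure (f ` V) \<inter> f ` D i - f ` J \<noteq> {}" using fcl[OF clC(1)] by blast
    show "closure (f ` W) \<inter> f ` D i \<noteq> {}" using D(6)[OF i] fcl[OF clC(2)] by blast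
    show "f ` D i \<inter> f ` J \<noteq> {}" using D(7)[OF i] by blast
  qed
qed

lemma locally_connected_Chat: "locally connected Chat"
  unfolding Chat_def by (rule locally_connected_sphere)

text \<open>\<open>V\<close> is built to meet \<open>J\<close> in exactly an open arc around
  \<open>x\<close>. What remains of \<open>J\<close> is then one closed arc, and only its two end
  points can be added by the closure of \<open>V\<close>.\<close>

lemma simple_closed_curve_neighbourhood:
  assumes J: "simple_closed_curve J" and x: "x \<in> J" and e: "0 < e"
  obtains V where "openin (top_of_set Chat) V" "connected V" "x \<in> V" "V \<subseteq> ball x e"
    "connected (J - V)" "finite (closure V \<inter> J - V)"
proof -
  obtain c where c: "simple_path c" "pathfinish c = pathstart c" "path_image c = J" "c (1/2) = x"
    using simple_closed_curve_path[OF J x] by blast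
  have contc: "continuous_on {0..1} c" using c(1) by (simp add: simple_path_def path_def)
  have c01: "c 0 = c 1" using c(2) by (simp add: pathstart_def pathfinish_def)
  have lf: "s = t \<or> s = 0 \<and> t = 1 \<or> s = 1 \<and> t = 0" if "c s = c t" "s \<in> {0..1}" "t \<in> {0..1}" for s t
    using c(1) that unfolding simple_path_def loop_free_def by blast
  have half: "(1/2 :: real) \<in> {0..1}" by simp
  obtain d0 where d0: "d0 > 0" "\<And>t. t \<in> {0..1} \<Longrightarrow> dist t (1/2) < d0 \<Longrightarrow> dist (c t) (c (1/2)) < e"
    using bspec[OF contc[unfolded continuous_on_iff] half] e by blast
  \<comment> \<open>The bound 1/4 leaves a nondegenerate interval on each side, and these are glued
    at \<open>c 0 = c 1\<close>; the bound \<open>d0/2\<close> keeps the arc in the ball.\<close>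
  define d where "d = min (d0/2) (1/4)"
  have d: "0 < d" "d < d0" "d < 1/2" using d0(1) by (auto simp: d_def)
  define G where "G = c ` {1/2 - d <..< 1/2 + d}"
  define A where "A = c ` {0..1/2 - d} \<union> c ` {1/2 + d..1}"
  have cA: "connected A"
  proof -
    have "connected (c ` {0..1/2 - d})" "connected (c ` {1/2 + d..1})"
      using d by (auto intro!: connected_continuous_image continuous_on_subset[OF contc])
    moreover have "c 0 \<in> c ` {0..1/2 - d}" using d by (intro imageI) auto
    moreover have "c 0 \<in> c ` {1/2 + d..1}" unfolding c01 using d by (intro imageI) auto
    ultimately show ?thesis unfolding A_def by (intro connected_Un) blast+
  qed
  have kA: "compact A" unfolding A_def
    using d by (intro compact_Un compact_continuous_image continuous_on_subset[OF contc]) auto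
  have GA: "G \<inter> A = {}"
  proof (rule ccontr)
    assume "G \<inter> A \<noteq> {}"
    then obtain s t where "s \<in> {1/2 - d <..< 1/2 + d}" "t \<in> {0..1/2 - d} \<union> {1/2 + d..1}" "c s = c t"
      unfolding G_def A_def by blast
    then show False using lf[of s t] d by auto
  qed
  have JGA: "J = G \<union> A"
  proof -
    have "{0..1} = {1/2 - d <..< 1/2 + d} \<union> ({0..1/2 - d} \<union> {1/2 + d..1})" using d by auto
    then show ?thesis unfolding c(3)[symmetric] path_image_def G_def A_def by (metis image_Un)
  qed
  have xG: "x \<in> G" using d c(4) by (auto simp: G_def intro!: image_eqI[of _ _ "1/2"])
  have Gb: "G \<subseteq> ball x e"
  proof
    fix p assume "p \<in> G"
    then obtain t where t: "t \<in> {1/2 - d <..< 1/2 + d}" "p = c t" by (auto simp: G_def)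
    then have "dist (c t) (c (1/2)) < e" using d by (intro d0) (auto simp: dist_real_def)
    then show "p \<in> ball x e" using t c(4) by (simp add: dist_commute)
  qed
  have clG: "closure G \<inter> A \<subseteq> {c (1/2 - d), c (1/2 + d)}"
  proof
    fix p assume p: "p \<in> closure G \<inter> A"
    have "compact (c ` {1/2 - d..1/2 + d})"
      using d by (intro compact_continuous_image continuous_on_subset[OF contc]) auto
    moreover have "G \<subseteq> c ` {1/2 - d..1/2 + d}" by (auto simp: G_def)
    ultimately have "closure G \<subseteq> c ` {1/2 - d..1/2 + d}"
      by (intro closure_minimal compact_imp_closed)
    then obtain s where s: "s \<in> {1/2 - d..1/2 + d}" "p = c s" using p by auto
    then have "s \<notin> {1/2 - d <..< 1/2 + d}" using p GA unfolding G_def by blast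
    then have "s = 1/2 - d \<or> s = 1/2 + d" using s by auto
    then show "p \<in> {c (1/2 - d), c (1/2 + d)}" using s by auto
  qed
  have Ane: "A \<noteq> {}" using d by (auto simp: A_def)
  \<comment> \<open>Points nearer to the arc than to the rest of the curve. The inequality excludes
    \<open>A\<close>, and its weak form survives in the closure: at a point of \<open>A\<close> it
    forces distance 0 from \<open>G\<close>, which leaves only the end points.\<close>
  define \<Omega> where "\<Omega> = Chat \<inter> ({z. infdist z G < infdist z A / 2} \<inter> ball x e)"
  have "open {z. infdist z G < infdist z A / 2}"
    by (intro open_Collect_less continuous_intros) auto
  then have op: "openin (top_of_set Chat) \<Omega>"
    unfolding \<Omega>_def by (intro openin_open_Int open_Int) auto
  have G\<Omega>: "G \<subseteq> \<Omega>"
  proof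
    fix z assume z: "z \<in> G"
    then have "z \<notin> A" using GA by auto
    then have "0 < infdist z A"
      using kA Ane by (metis compact_imp_closed in_closed_iff_infdist_zero infdist_nonneg order_less_le)
    moreover have "z \<in> Chat" using z JGA J by (auto simp: simple_closed_curve_def)
    ultimately show "z \<in> \<Omega>" using z Gb by (auto simp: \<Omega>_def)
  qed
  define V where "V = connected_component_set \<Omega> x"
  have V\<Omega>: "V \<subseteq> \<Omega>" unfolding V_def by (rule connected_component_subset)
  have "connected G" unfolding G_def
    using d by (intro connected_continuous_image continuous_on_subset[OF contc]) auto
  then have GV: "G \<subseteq> V" unfolding V_def using xG G\<Omega> by (intro connected_component_maximal)
  have "z \<notin> \<Omega>" if "z \<in> A" for z using that infdist_nonneg[of z G] by (simp add: \<Omega>_def)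
  then have JV: "J - V = A" using JGA GV V\<Omega> GA by blast
  have "closure V \<inter> A \<subseteq> closure G \<inter> A"
  proof
    fix z assume z: "z \<in> closure V \<inter> A"
    have "closed {z. infdist z G \<le> infdist z A / 2}"
      by (intro closed_Collect_le continuous_intros) auto
    moreover have "V \<subseteq> {z. infdist z G \<le> infdist z A / 2}" using V\<Omega> by (auto simp: \<Omega>_def)
    ultimately have "closure V \<subseteq> {z. infdist z G \<le> infdist z A / 2}" by (rule closure_minimal[rotated])
    then have "infdist z G \<le> infdist z A / 2" using z by blast
    then have "infdist z G = 0" using z infdist_nonneg[of z G] by simp
    then show "z \<in> closure G \<inter> A" using z xG by (metis Int_iff empty_iff in_closure_iff_infdist_zero)
  qed
  then have "closure V \<inter> A \<subseteq> {c (1/2 - d), c (1/2 + d)}" using clG by (rule order_trans)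
  then have "finite (closure V \<inter> A)" by (rule finite_subset) simp
  moreover have "closure V \<inter> J - V = closure V \<inter> A" using JV by blast
  ultimately have fin: "finite (closure V \<inter> J - V)" by simp
  show ?thesis
  proof
    show "openin (top_of_set Chat) V"
      unfolding V_def using locally_connected_2[OF locally_connected_Chat op] xG G\<Omega> by blast
    show "connected V" by (simp add: V_def)
    show "x \<in> V" using GV xG by blast
    show "V \<subseteq> ball x e" using V\<Omega> by (auto simp: \<Omega>_def)
    show "connected (J - V)" using JV cA by simp
  qed (rule fin)
qed

section \<open>Components that remain after removing open sets\<close>

lemma crossing_component:
  fixes X :: "'a::euclidean_space set"
  assumes X: "compact X" "connected X"
    and U: "openin (top_of_set X) U" "U \<noteq> {}" and V: "openin (top_of_set X) V" "V \<noteq> {}"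
    and UV: "U \<inter> V = {}"
  obtains D where "D \<in> components (X - (U \<union> V))" "D \<inter> closure U \<noteq> {}" "D \<inter> closure V \<noteq> {}"
proof -
  define F where "F = X - (U \<union> V)"
  have UVX: "U \<subseteq> X" "V \<subseteq> X" using U V openin_imp_subset by blast+
  have clX: "closure U \<subseteq> X" "closure V \<subseteq> X"
    using UVX X(1) by (simp_all add: closure_minimal compact_imp_closed)
  obtain U' where U': "open U'" "U = X \<inter> U'" using U(1) by (auto simp: openin_open)
  obtain V' where V': "open V'" "V = X \<inter> V'" using V(1) by (auto simp: openin_open)
  have "F = X - (U' \<union> V')" using U' V' by (auto simp: F_def)
  then have kF: "compact F" using X(1) U' V' by (simp add: compact_diff open_Un)
  have dUV: "closure U \<inter> V = {}"
  proof -
    have "U \<inter> V' = {}" using U' V' UV by auto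
    then have "closure U \<inter> V' = {}" using V'(1) open_Int_closure_eq_empty by (metis Int_commute)
    then show ?thesis using V' by auto
  qed
  have dVU: "closure V \<inter> U = {}"
  proof -
    have "V \<inter> U' = {}" using U' V' UV by auto
    then have "closure V \<inter> U' = {}" using U'(1) open_Int_closure_eq_empty by (metis Int_commute)
    then show ?thesis using U' by auto
  qed
  have "\<exists>D \<in> components F. D \<inter> closure U \<noteq> {} \<and> D \<inter> closure V \<noteq> {}"
  proof (rule ccontr)
    assume no: "\<not> ?thesis"
    \<comment> \<open>If no component reaches both closures, \<open>F\<close> splits into disjoint
      closed parts, one taking the contact with \<open>U\<close> and the other that with
      \<open>V\<close>. Adding \<open>U\<close> and \<open>V\<close> to their parts would then
      disconnect the continuum \<open>X\<close>.\<close>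
    have "separated_between (top_of_set F) (F \<inter> closure U) (F \<inter> closure V)"
    proof (rule cut_wire_fence_theorem)
      show "compact_space (top_of_set F)" using kF by (simp add: compact_space_subtopology)
      show "Hausdorff_space (top_of_set F)" by (simp add: Hausdorff_space_subtopology)
      show "closedin (top_of_set F) (F \<inter> closure U)" "closedin (top_of_set F) (F \<inter> closure V)"
        by (simp_all add: closedin_closed_Int)
      fix C assume "connectedin (top_of_set F) C"
      then have C: "connected C" "C \<subseteq> F" by (auto simp: connectedin_subtopology)
      show "disjnt C (F \<inter> closure U) \<or> disjnt C (F \<inter> closure V)"
      proof (cases "C = {}")
        case False
        then obtain E where E: "E \<in> components F" "C \<subseteq> E"
          using exists_component_superset[OF C(2) _ C(1)] C(2) by auto
        then show ?thesis using no unfolding disjnt_def by blast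
      qed simp
    qed
    then obtain A B where AB: "closedin (top_of_set F) A" "closedin (top_of_set F) B"
       "A \<union> B = F" "disjnt A B" "F \<inter> closure U \<subseteq> A" "F \<inter> closure V \<subseteq> B"
      unfolding separated_between_alt by auto
    have clAB: "closed A" "closed B"
      using AB(1,2) kF closedin_closed_trans compact_imp_closed by blast+
    have "U \<union> A = closure U \<union> A"
      using clX dUV AB(5) closure_subset[of U] unfolding F_def by blast
    then have 1: "closed (U \<union> A)" using clAB by (simp add: closed_Un)
    have "V \<union> B = closure V \<union> B"
      using clX dVU AB(6) closure_subset[of V] unfolding F_def by blast
    then have 2: "closed (V \<union> B)" using clAB by (simp add: closed_Un)
    have "X \<subseteq> (U \<union> A) \<union> (V \<union> B)" using AB(3) by (auto simp: F_def)
    moreover have "(U \<union> A) \<inter> (V \<union> B) \<inter> X = {}"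
      using AB(3,4) UV unfolding F_def disjnt_def by blast
    ultimately show False
      using connected_closedD[OF X(2) _ _ 1 2] UVX U V by blast
  qed
  then show ?thesis using that unfolding F_def by blast
qed

lemma components_Diff_component:
  assumes "C \<in> components S" "D \<in> components (C - A)"
  shows "D \<in> components (S - A)"
proof -
  have C: "C \<subseteq> S" using assms in_components_subset by blast
  have D: "D \<noteq> {}" "D \<subseteq> C - A" "connected D"
    "\<And>E. E \<noteq> {} \<Longrightarrow> D \<subseteq> E \<Longrightarrow> E \<subseteq> C - A \<Longrightarrow> connected E \<Longrightarrow> E = D"
    using assms(2) unfolding in_components_maximal by auto
  have max: "E = D" if E: "E \<noteq> {}" "D \<subseteq> E" "E \<subseteq> S - A" "connected E" for E
  proof (rule D(4)[OF E(1,2) _ E(4)])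
    have "E \<subseteq> C" using components_maximal[OF assms(1) E(4)] E D by blast
    then show "E \<subseteq> C - A" using E by blast
  qed
  moreover have "D \<subseteq> S - A" using D(2) C by blast
  ultimately show ?thesis unfolding in_components_maximal using D(1,3) by metis
qed

text \<open>By the Sura-Bura theorem a compact relatively open \<open>K\<close> fits between
  \<open>D\<close> and \<open>U\<close>. Since \<open>U\<close> is open in all of \<open>F\<close>,
  this \<open>K\<close> is clopen in \<open>F\<close> as well and traps the component of
  \<open>F\<close> around \<open>D\<close>. It will serve for pieces of the annulus that avoid both
  boundary curves.\<close>

lemma component_of_closed_part:
  fixes F :: "'a::euclidean_space set"
  assumes F: "compact F" and A: "closed A" and U: "openin (top_of_set F) U" "U \<subseteq> A"
    and D: "D \<in> components (A \<inter> F)" "D \<subseteq> U"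
  shows "D \<in> components F"
proof -
  have kAF: "compact (A \<inter> F)" using F A by (simp add: closed_Int_compact)
  have kD: "compact D" using D(1) kAF compact_components by blast
  have UF: "U \<subseteq> F" using U openin_imp_subset by blast
  have oU: "openin (top_of_set (A \<inter> F)) U"
    using U UF by (meson Int_lower2 le_inf_iff openin_subset_trans)
  obtain K where K: "openin (top_of_set (A \<inter> F)) K" "compact K" "D \<subseteq> K" "K \<subseteq> U"
    using Sura_Bura_clopen_subset_alt[OF closed_imp_locally_compact[OF compact_imp_closed[OF kAF]] D(1) kD oU D(2)] .
  have "openin (top_of_set U) K" using K U UF by (meson le_inf_iff openin_subset_trans)
  then have oK: "openin (top_of_set F) K" using U(1) openin_trans by blast
  have D1: "D \<noteq> {}" "connected D" using D(1) in_components_nonempty in_components_connected by auto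
  obtain C where C: "C \<in> components F" "D \<subseteq> C"
    using exists_component_superset[of D F] D1 D(2) UF by blast
  have C1: "connected C" "C \<subseteq> F" using in_components_connected[OF C(1)] in_components_subset[OF C(1)] by auto
  have "F \<inter> K = K" using openin_imp_subset[OF oK] by blast
  then have "openin (top_of_set C) (C \<inter> K)"
    using openin_subtopology_Int_subset[of F K C] oK C1(2) by simp
  moreover have "closedin (top_of_set C) (C \<inter> K)" using K(2) by (simp add: closedin_closed_Int compact_imp_closed)
  ultimately have "C \<inter> K = {} \<or> C \<inter> K = C"
    using connected_clopen[THEN iffD1, OF C1(1), rule_format, of "C \<inter> K"] by blast
  then have "C \<subseteq> K" using C(2) K(3) D1(1) by blast
  then have "C \<subseteq> A \<inter> F" using K U UF by blast
  then have "C \<subseteq> D" using components_maximal[OF D(1) C1(1)] C(2) D1(1) by blast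
  then show ?thesis using C by auto
qed

text \<open>A contact with the closure of \<open>V\<close> that lies on \<open>J\<close> is one of
  finitely many points, and disjoint continua cannot share such a point. After discarding the
  continua concerned, three of the others would contradict
  \<open>sphere_three_continua\<close>.\<close>

lemma finitely_many_continua_touch_curve:
  fixes D :: "nat \<Rightarrow> (real^3) set"
  assumes J: "simple_closed_curve J" and R: "R \<in> components (Chat - J)"
    and q: "q \<in> Chat - J" "q \<notin> R" "q \<notin> closure V" "q \<notin> closure W"
    and V: "openin (top_of_set Chat) V" "connected V" "connected (J - V)" "finite (closure V \<inter> J - V)"
    and W: "openin (top_of_set Chat) W" "connected W" "closure W \<inter> J = {}" "closure V \<inter> closure W = {}"
    and D: "\<And>i. i \<in> S \<Longrightarrow> compact (D i)" "\<And>i. i \<in> S \<Longrightarrow> connected (D i)"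
      "\<And>i. i \<in> S \<Longrightarrow> D i \<subseteq> J \<union> R" "\<And>i. i \<in> S \<Longrightarrow> D i \<inter> (V \<union> W) = {}"
      "\<And>i. i \<in> S \<Longrightarrow> D i \<inter> closure V \<noteq> {}" "\<And>i. i \<in> S \<Longrightarrow> D i \<inter> closure W \<noteq> {}"
      "\<And>i. i \<in> S \<Longrightarrow> D i \<inter> J \<noteq> {}"
    and DD: "\<And>i j. \<lbrakk>i \<in> S; j \<in> S; i \<noteq> j\<rbrakk> \<Longrightarrow> D i \<inter> D j = {}"
  shows "finite S"
proof (rule ccontr)
  assume inf: "infinite S"
  define B where "B = closure V \<inter> J - V"
  define S1 where "S1 = {i \<in> S. D i \<inter> B \<noteq> {}}"
  have "\<forall>i. \<exists>b. i \<in> S1 \<longrightarrow> b \<in> D i \<inter> B" by (auto simp: S1_def)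
  then obtain b where b: "\<And>i. i \<in> S1 \<Longrightarrow> b i \<in> D i \<inter> B" by metis
  have "inj_on b S1"
  proof (rule inj_onI)
    fix i j assume ij: "i \<in> S1" "j \<in> S1" "b i = b j"
    then have "D i \<inter> D j \<noteq> {}" using b[of i] b[of j] by auto
    then show "i = j" using DD[of i j] ij by (auto simp: S1_def)
  qed
  moreover have "b ` S1 \<subseteq> B" using b by blast
  ultimately have "finite S1" using V(4) unfolding B_def by (meson finite_imageD finite_subset)
  then have "infinite (S - S1)" using inf by simp
  then obtain r :: "nat \<Rightarrow> nat" where r: "strict_mono r" "\<And>n. r n \<in> S - S1"
    using infinite_enumerate by blast
  have rS: "r i \<in> S" for i using r(2) by blast
  show False
  proof (rule sphere_three_continua[OF J R q V(1-3) W, of "\<lambda>i. D (r i)"])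
    show "D (r i) \<inter> D (r j) = {}" if "i \<noteq> j" for i j
      using DD[OF rS rS] r(1) that by (metis strict_mono_eq)
    fix i :: nat
    show "compact (D (r i))" "connected (D (r i))" "D (r i) \<subseteq> J \<union> R" "D (r i) \<inter> (V \<union> W) = {}"
      "closure W \<inter> D (r i) \<noteq> {}" "D (r i) \<inter> J \<noteq> {}" 
      using D[OF rS] by (auto simp: Int_commute)
    have "D (r i) \<inter> B = {}" using r(2)[of i] by (auto simp: S1_def)
    then show "closure V \<inter> D (r i) - J \<noteq> {}" using D(4,5)[OF rS[of i]] by (auto simp: B_def)
  qed
qed

section \<open>Crossing components\<close>

lemma infinite_crossing_components:
  fixes K :: "(real^3) set"
  assumes K: "compact K" "K \<subseteq> Chat"
    and J1: "simple_closed_curve J1" "x \<in> J1" and J2: "simple_closed_curve J2" "y \<in> J2"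
    and JJ: "J1 \<inter> J2 = {}"
    and U: "U \<in> components (Chat - (J1 \<union> J2))" "(top_of_set Chat) frontier_of U = J1 \<union> J2"
    and P: "inj P" "\<And>n. P n \<in> components (closure U \<inter> K)"
    and L: "hausdorff_converges P L" "x \<in> L" "y \<in> L"
    and Ux: "openin (top_of_set K) Ux" "x \<in> Ux" and Uy: "openin (top_of_set K) Uy" "y \<in> Uy"
    and dxy: "Ux \<inter> Uy = {}"
  shows "infinite {C \<in> components (K - (Ux \<union> Uy)).
           C \<inter> ((top_of_set K) frontier_of Ux) \<noteq> {} \<and> C \<inter> ((top_of_set K) frontier_of Uy) \<noteq> {}}"
proof
  define T where "T = {C \<in> components (K - (Ux \<union> Uy)).
           C \<inter> ((top_of_set K) frontier_of Ux) \<noteq> {} \<and> C \<inter> ((top_of_set K) frontier_of Uy) \<noteq> {}}"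
  assume "finite {C \<in> components (K - (Ux \<union> Uy)).
           C \<inter> ((top_of_set K) frontier_of Ux) \<noteq> {} \<and> C \<inter> ((top_of_set K) frontier_of Uy) \<noteq> {}}"
  then have finT: "finite T" by (simp add: T_def)
  have kJ: "compact J1" "compact J2" using J1 J2 simple_closed_curve_compact by auto
  have JC: "J1 \<subseteq> Chat" "J2 \<subseteq> Chat" using J1 J2 by (auto simp: simple_closed_curve_def)
  have cC: "closed Chat" by (simp add: Chat_def)
  have U1: "U \<noteq> {}" "connected U" "U \<subseteq> Chat - (J1 \<union> J2)"
    using U(1) in_components_nonempty in_components_connected in_components_subset by blast+
  have oCJ: "openin (top_of_set Chat) (Chat - (J1 \<union> J2))"
    using kJ by (intro openin_diff) (auto simp: closed_subset compact_imp_closed JC closed_Un)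
  have oU: "openin (top_of_set Chat) U"
    using openin_components_locally_connected[OF locally_open_subset[OF locally_connected_Chat oCJ] U(1)]
      oCJ openin_trans by blast
  have clUC: "closure U \<subseteq> Chat" using U1(3) cC by (intro closure_minimal) auto
  have "closure U - U = J1 \<union> J2"
    using U(2) oU clUC U1(3) unfolding frontier_of_def
    by (simp add: interior_of_openin closure_of_subtopology Int_absorb1 Int_absorb2 subset_trans[of U])
  then have clU: "closure U = U \<union> (J1 \<union> J2)" using closure_subset[of U] by blast
  have UJ: "connected (U \<union> J1)" "connected (U \<union> J2)"
    using clU by (auto intro!: connected_intermediate_closure[OF U1(2)])
  \<comment> \<open>Seen from one curve alone, the annulus and the other curve lie on one side;
    \<open>q1\<close> and \<open>q2\<close> are poles on the opposite sides.\<close>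
  obtain R1 where R1: "R1 \<in> components (Chat - J1)" "U \<union> J2 \<subseteq> R1"
    using exists_component_superset[OF _ _ UJ(2), of "Chat - J1"] U1 JC JJ by blast
  obtain R2 where R2: "R2 \<in> components (Chat - J2)" "U \<union> J1 \<subseteq> R2"
    using exists_component_superset[OF _ _ UJ(1), of "Chat - J2"] U1 JC JJ by blast
  obtain q1 where q1: "q1 \<in> Chat - J1" "q1 \<notin> R1" using curve_two_sides[OF J1(1) R1(1)] .
  obtain q2 where q2: "q2 \<in> Chat - J2" "q2 \<notin> R2" using curve_two_sides[OF J2(1) R2(1)] .
  have xy: "x \<noteq> y" using J1 J2 JJ by auto
  obtain Ox where Ox: "open Ox" "Ux = K \<inter> Ox" using Ux(1) by (auto simp: openin_open)
  obtain Oy where Oy: "open Oy" "Uy = K \<inter> Oy" using Uy(1) by (auto simp: openin_open)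
  \<comment> \<open>The two balls lie in the given open sets, are disjoint, and avoid the opposite
    curve and both poles, so that either curve can later be treated with its own pole.\<close>
  obtain e1 where e1: "e1 > 0" "cball x e1 \<subseteq> ((Ox - J2) - {q1, q2}) \<inter> ball x (dist x y / 2)"
  proof -
    have "open (((Ox - J2) - {q1, q2}) \<inter> ball x (dist x y / 2))"
      using Ox kJ by (intro open_Int open_Diff) (auto simp: compact_imp_closed)
    moreover have "x \<in> ((Ox - J2) - {q1, q2}) \<inter> ball x (dist x y / 2)"
      using Ux(2) Ox JJ J1 q1 q2 R2 xy by auto
    ultimately show ?thesis using that open_contains_cball by blast
  qed
  obtain e2 where e2: "e2 > 0" "cball y e2 \<subseteq> ((Oy - J1) - {q1, q2}) \<inter> ball y (dist x y / 2)"
  proof -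
    have "open (((Oy - J1) - {q1, q2}) \<inter> ball y (dist x y / 2))"
      using Oy kJ by (intro open_Int open_Diff) (auto simp: compact_imp_closed)
    moreover have "y \<in> ((Oy - J1) - {q1, q2}) \<inter> ball y (dist x y / 2)"
      using Uy(2) Oy JJ J2 q1 q2 R1 xy by auto
    ultimately show ?thesis using that open_contains_cball by blast
  qed
  obtain V where V: "openin (top_of_set Chat) V" "connected V" "x \<in> V" "V \<subseteq> ball x e1"
    "connected (J1 - V)" "finite (closure V \<inter> J1 - V)"
    using simple_closed_curve_neighbourhood[OF J1 e1(1)] .
  obtain W where W: "openin (top_of_set Chat) W" "connected W" "y \<in> W" "W \<subseteq> ball y e2"
    "connected (J2 - W)" "finite (closure W \<inter> J2 - W)"
    using simple_closed_curve_neighbourhood[OF J2 e2(1)] .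
  have clV: "closure V \<subseteq> cball x e1" using V(4) by (meson ball_subset_cball closed_cball closure_minimal subset_trans)
  have clW: "closure W \<subseteq> cball y e2" using W(4) by (meson ball_subset_cball closed_cball closure_minimal subset_trans)
  have "ball x (dist x y / 2) \<inter> ball y (dist x y / 2) = {}" by (rule disjoint_ballI) simp
  then have VW: "closure V \<inter> closure W = {}" using clV clW e1(2) e2(2) by blast
  have VUx: "K \<inter> closure V \<subseteq> Ux" using clV e1(2) Ox by blast
  have WUy: "K \<inter> closure W \<subseteq> Uy" using clW e2(2) Oy by blast
  have V_cl: "V \<subseteq> closure V" "W \<subseteq> closure W" by (rule closure_subset)+
  obtain V' where V': "open V'" "V = Chat \<inter> V'" using V(1) by (auto simp: openin_open)
  obtain W' where W': "open W'" "W = Chat \<inter> W'" using W(1) by (auto simp: openin_open)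
  define F where "F = K - (V \<union> W)"
  have "F = K - (V' \<union> W')" using K V' W' by (auto simp: F_def)
  then have kF: "compact F" using K V' W' by (simp add: compact_diff open_Un)
  have kAK: "compact (closure U \<inter> K)" using K by (simp add: closed_Int_compact)
  have Pn: "compact (P n)" "connected (P n)" "P n \<subseteq> closure U \<inter> K" for n
    using P(2)[of n] kAK compact_components in_components_connected in_components_subset by blast+
  have PP: "P n \<inter> P m = {}" if "n \<noteq> m" for n m
    using components_nonoverlap[OF P(2) P(2)] that P(1) by (auto dest: injD)
  \<comment> \<open>The \<open>P n\<close> may touch the curves far from \<open>x\<close> and
    \<open>y\<close>; it is the Hausdorff limit that drives them into both \<open>V\<close> and
    \<open>W\<close>.\<close>
  have hit: "eventually (\<lambda>n. P n \<inter> Q \<noteq> {}) sequentially" if Q: "open Q'" "Q = Chat \<inter> Q'" "z \<in> Q" "z \<in> L" for Q Q' z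
  proof -
    obtain r where r: "r > 0" "ball z r \<subseteq> Q'" using Q by (metis Int_iff open_contains_ball)
    have "eventually (\<lambda>n. (\<forall>a\<in>P n. \<exists>b\<in>L. dist a b < r) \<and> (\<forall>b\<in>L. \<exists>a\<in>P n. dist a b < r)) sequentially"
      using L(1) r(1) unfolding hausdorff_converges_def by blast
    then show ?thesis
    proof (rule eventually_mono)
      fix n assume "(\<forall>a\<in>P n. \<exists>b\<in>L. dist a b < r) \<and> (\<forall>b\<in>L. \<exists>a\<in>P n. dist a b < r)"
      then obtain a where "a \<in> P n" "dist a z < r" using Q(4) by blast
      moreover have "a \<in> Chat" using calculation(1) Pn(3) K(2) by blast
      ultimately have "a \<in> Q" using r(2) Q(2) by (auto simp: dist_commute)
      then show "P n \<inter> Q \<noteq> {}" using \<open>a \<in> P n\<close> by blast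
    qed
  qed
  have "eventually (\<lambda>n. P n \<inter> V \<noteq> {} \<and> P n \<inter> W \<noteq> {}) sequentially"
    using eventually_conj[OF hit[OF V' V(3) L(2)] hit[OF W' W(3) L(3)]] .
  then obtain N where N: "\<And>n. n \<ge> N \<Longrightarrow> P n \<inter> V \<noteq> {} \<and> P n \<inter> W \<noteq> {}"
    unfolding eventually_sequentially by blast
  have "\<exists>D. D \<in> components (P n - (V \<union> W)) \<and> D \<inter> closure V \<noteq> {} \<and> D \<inter> closure W \<noteq> {}" if n: "n \<ge> N" for n
  proof -
    have PC: "P n \<subseteq> Chat" using Pn K by blast
    have "openin (top_of_set (P n)) (P n \<inter> V')" "openin (top_of_set (P n)) (P n \<inter> W')"
      using V' W' by auto
    moreover have eq: "P n \<inter> V' = P n \<inter> V" "P n \<inter> W' = P n \<inter> W" using PC V' W' by auto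
    ultimately have o: "openin (top_of_set (P n)) (P n \<inter> V)" "openin (top_of_set (P n)) (P n \<inter> W)" by auto
    obtain D where D: "D \<in> components (P n - (P n \<inter> V \<union> P n \<inter> W))"
       "D \<inter> closure (P n \<inter> V) \<noteq> {}" "D \<inter> closure (P n \<inter> W) \<noteq> {}"
      using crossing_component[OF Pn(1,2) o(1) _ o(2)] N[OF n] VW V_cl by blast
    have "P n - (P n \<inter> V \<union> P n \<inter> W) = P n - (V \<union> W)" by blast
    then have "D \<in> components (P n - (V \<union> W))" using D(1) by simp
    moreover have "closure (P n \<inter> V) \<subseteq> closure V" "closure (P n \<inter> W) \<subseteq> closure W"
      by (intro closure_mono; blast)+
    then have "D \<inter> closure V \<noteq> {}" "D \<inter> closure W \<noteq> {}" using D(2,3) by blast+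
    ultimately show ?thesis by blast
  qed
  then have "\<forall>n. \<exists>D. n \<ge> N \<longrightarrow> D \<in> components (P n - (V \<union> W)) \<and> D \<inter> closure V \<noteq> {} \<and> D \<inter> closure W \<noteq> {}"
    by blast
  from choice[OF this] obtain D where "\<forall>n\<ge>N. D n \<in> components (P n - (V \<union> W)) \<and> D n \<inter> closure V \<noteq> {} \<and> D n \<inter> closure W \<noteq> {}" ..
  then have D: "\<And>n. n \<ge> N \<Longrightarrow> D n \<in> components (P n - (V \<union> W))"
    "\<And>n. n \<ge> N \<Longrightarrow> D n \<inter> closure V \<noteq> {}" "\<And>n. n \<ge> N \<Longrightarrow> D n \<inter> closure W \<noteq> {}" by auto
  have D1: "D n \<noteq> {}" "connected (D n)" "D n \<subseteq> P n - (V \<union> W)" if "n \<ge> N" for n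
    using D(1)[OF that] in_components_nonempty in_components_connected in_components_subset by blast+
  have DF: "D n \<subseteq> F" if "n \<ge> N" for n using D1(3)[OF that] Pn(3)[of n] by (auto simp: F_def)
  have DcF: "D n \<in> components (closure U \<inter> F)" if "n \<ge> N" for n
    using components_Diff_component[OF P(2) D(1)[OF that]] by (simp add: F_def Int_Diff)
  have kD: "compact (D n)" if "n \<ge> N" for n
    using DcF[OF that] kF compact_components by (metis closed_Int_compact closed_closure)
  have DD: "D n \<inter> D m = {}" if "n \<ge> N" "m \<ge> N" "n \<noteq> m" for n m
    using D1(3)[OF that(1)] D1(3)[OF that(2)] PP[OF that(3)] by blast
  \<comment> \<open>\<open>D n\<close> is a component only of the part of \<open>F\<close> in
    \<open>closure U\<close>. Since \<open>F\<close> may join such pieces outside, several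
    \<open>n\<close> can share the same \<open>E n\<close>.\<close>
  have "\<forall>n. \<exists>E. n \<ge> N \<longrightarrow> E \<in> components F \<and> D n \<subseteq> E"
    using exists_component_superset[of _ F] D1 DF by (metis subset_empty)
  from choice[OF this] obtain E where "\<forall>n\<ge>N. E n \<in> components F \<and> D n \<subseteq> E n" ..
  then have E: "\<And>n. n \<ge> N \<Longrightarrow> E n \<in> components F" "\<And>n. n \<ge> N \<Longrightarrow> D n \<subseteq> E n" by auto
  \<comment> \<open>Shrinking the neighbourhoods can only merge crossing components: each one for V, W contains
    one for Ux, Uy.\<close>
  have "\<exists>C. C \<in> T \<and> C \<subseteq> E n" if n: "n \<ge> N" for n
  proof -
    have En: "compact (E n)" "connected (E n)" "E n \<subseteq> F"
      using E(1)[OF n] kF compact_components in_components_connected in_components_subset by blast+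
    have EK: "E n \<subseteq> K" using En F_def by blast
    have "openin (top_of_set (E n)) (E n \<inter> Ox)" "openin (top_of_set (E n)) (E n \<inter> Oy)"
      using Ox Oy by auto
    moreover have "E n \<inter> Ox = E n \<inter> Ux" "E n \<inter> Oy = E n \<inter> Uy" using EK Ox Oy by auto
    ultimately have o: "openin (top_of_set (E n)) (E n \<inter> Ux)" "openin (top_of_set (E n)) (E n \<inter> Uy)" by auto
    have DK: "D n \<subseteq> K" using E(2)[OF n] EK by blast
    then have ne: "E n \<inter> Ux \<noteq> {}" "E n \<inter> Uy \<noteq> {}"
      using D(2,3)[OF n] VUx WUy E(2)[OF n] by blast+
    obtain C where C: "C \<in> components (E n - (E n \<inter> Ux \<union> E n \<inter> Uy))"
       "C \<inter> closure (E n \<inter> Ux) \<noteq> {}" "C \<inter> closure (E n \<inter> Uy) \<noteq> {}"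
      using crossing_component[OF En(1,2) o(1) ne(1) o(2) ne(2)] dxy by blast
    have "E n - (E n \<inter> Ux \<union> E n \<inter> Uy) = E n - (Ux \<union> Uy)" by blast
    then have "C \<in> components (F - (Ux \<union> Uy))" using C(1) components_Diff_component[OF E(1)[OF n]] by simp
    moreover have "F - (Ux \<union> Uy) = K - (Ux \<union> Uy)" using VUx WUy V_cl by (auto simp: F_def)
    ultimately have CK: "C \<in> components (K - (Ux \<union> Uy))" by simp
    have CE: "C \<subseteq> E n" using C(1) in_components_subset by blast
    have CU: "C \<inter> (Ux \<union> Uy) = {}" "C \<subseteq> K" using CK in_components_subset by blast+
    have fr: "(top_of_set K) frontier_of S = K \<inter> closure S - S" if "openin (top_of_set K) S" for S
      using that openin_imp_subset[OF that] unfolding frontier_of_def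
      by (simp add: interior_of_openin closure_of_subtopology Int_absorb1 Int_absorb2)
    have "closure (E n \<inter> Ux) \<subseteq> closure Ux" "closure (E n \<inter> Uy) \<subseteq> closure Uy"
      by (intro closure_mono; blast)+
    then have "C \<in> T" unfolding T_def fr[OF Ux(1)] fr[OF Uy(1)] using CK C CU by blast
    then show ?thesis using CE by blast
  qed
  then have "\<forall>X. \<exists>C. X \<in> E ` {N..} \<longrightarrow> C \<in> T \<and> C \<subseteq> X" by blast
  from choice[OF this] obtain h where h: "\<forall>X. X \<in> E ` {N..} \<longrightarrow> h X \<in> T \<and> h X \<subseteq> X" ..
  \<comment> \<open>Different components \<open>E n\<close> contain different members of
    \<open>T\<close>, so there are finitely many of them and one contains infinitely many
    \<open>D n\<close>.\<close>
  have "inj_on h (E ` {N..})"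
  proof (rule inj_onI)
    fix X Y assume X: "X \<in> E ` {N..}" "Y \<in> E ` {N..}" "h X = h Y"
    have "h X \<noteq> {}" using h X(1) in_components_nonempty by (auto simp: T_def)
    then have "X \<inter> Y \<noteq> {}" using h X by (metis Int_greatest subset_empty)
    then show "X = Y" using components_nonoverlap[of X F Y] X E(1) by auto
  qed
  moreover have "h ` (E ` {N..}) \<subseteq> T" using h by blast
  ultimately have "finite (E ` {N..})" using finT by (meson finite_imageD finite_subset)
  then obtain n0 where n0: "n0 \<ge> N" "infinite {n \<in> {N..}. E n = E n0}"
    using pigeonhole_infinite[of "{N..}" E] by (auto simp: infinite_Ici)
  define S where "S = {n \<in> {N..}. E n = E n0}"
  have infS: "infinite S" using n0 by (simp add: S_def)
  have SN: "n \<ge> N" if "n \<in> S" for n using that by (auto simp: S_def)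
  \<comment> \<open>A \<open>D n\<close> off both curves would be a full component of
    \<open>F\<close>, hence equal to \<open>E n0\<close>, leaving no room for a disjoint
    \<open>D m\<close> in it.\<close>
  have touch: "D n \<inter> (J1 \<union> J2) \<noteq> {}" if n: "n \<in> S" for n
  proof
    assume dis: "D n \<inter> (J1 \<union> J2) = {}"
    have oUF: "openin (top_of_set F) (F \<inter> U)"
    proof -
      have "Chat \<inter> U = U" using U1(3) by blast
      then show ?thesis using openin_subtopology_Int_subset[of Chat U F] oU K(2) by (auto simp: F_def)
    qed
    have "D n \<subseteq> F \<inter> U" using dis DF[OF SN[OF n]] in_components_subset[OF DcF[OF SN[OF n]]] clU by blast
    then have "D n \<in> components F"
      using component_of_closed_part[OF kF closed_closure oUF _ DcF[OF SN[OF n]]] closure_subset[of U] by blast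
    then have "D n = E n"
      using components_nonoverlap[OF _ E(1)[OF SN[OF n]]] E(2)[OF SN[OF n]] D1(1)[OF SN[OF n]] by blast
    moreover obtain m where m: "m \<in> S" "m \<noteq> n"
      using infS by (metis finite.emptyI finite_insert finite_subset insertCI subsetI singletonI)
    ultimately have "D m \<subseteq> D n" using E(2)[OF SN[OF m(1)]] n by (auto simp: S_def)
    then show False using DD[OF SN[OF m(1)] SN[OF n] m(2)] D1(1)[OF SN[OF m(1)]] by blast
  qed
  define S1 where "S1 = {n \<in> S. D n \<inter> J1 \<noteq> {}}"
  define S2 where "S2 = {n \<in> S. D n \<inter> J2 \<noteq> {}}"
  have DU: "D n \<subseteq> closure U" if "n \<in> S" for n using in_components_subset[OF DcF[OF SN[OF that]]] by blast
  \<comment> \<open>For \<open>J1\<close> the set \<open>V\<close> is the neighbourhood cutting out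
    an arc and \<open>W\<close> is the hub away from the curve; for \<open>J2\<close> they exchange
    roles.\<close>
  have "finite S1"
  proof (rule finitely_many_continua_touch_curve[OF J1(1) R1(1) q1, of V W S1 D])
    show "q1 \<notin> closure V" "q1 \<notin> closure W" using clV clW e1(2) e2(2) by blast+
    show "closure W \<inter> J1 = {}" using clW e2(2) by blast
    show "D i \<inter> D j = {}" if "i \<in> S1" "j \<in> S1" "i \<noteq> j" for i j
      using DD SN that by (auto simp: S1_def)
    fix n assume "n \<in> S1"
    then have n: "n \<in> S" "n \<ge> N" "D n \<inter> J1 \<noteq> {}" using SN by (auto simp: S1_def)
    show "compact (D n)" "connected (D n)" using kD D1 n by auto
    show "D n \<subseteq> J1 \<union> R1" using DU[OF n(1)] clU R1(2) by blast
    show "D n \<inter> (V \<union> W) = {}" using D1(3)[OF n(2)] by blast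
    show "D n \<inter> closure V \<noteq> {}" "D n \<inter> closure W \<noteq> {}" using D n(2) by auto
    show "D n \<inter> J1 \<noteq> {}" by (rule n(3))
  qed (use V W VW in auto)
  moreover have "finite S2"
  proof (rule finitely_many_continua_touch_curve[OF J2(1) R2(1) q2, of W V S2 D])
    show "q2 \<notin> closure V" "q2 \<notin> closure W" using clV clW e1(2) e2(2) by blast+
    show "closure V \<inter> J2 = {}" using clV e1(2) by blast
    show "D i \<inter> D j = {}" if "i \<in> S2" "j \<in> S2" "i \<noteq> j" for i j
      using DD SN that by (auto simp: S2_def)
    fix n assume "n \<in> S2"
    then have n: "n \<in> S" "n \<ge> N" "D n \<inter> J2 \<noteq> {}" using SN by (auto simp: S2_def)
    show "compact (D n)" "connected (D n)" using kD D1 n by auto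
    show "D n \<subseteq> J2 \<union> R2" using DU[OF n(1)] clU R2(2) by blast
    show "D n \<inter> (W \<union> V) = {}" using D1(3)[OF n(2)] by blast
    show "D n \<inter> closure V \<noteq> {}" "D n \<inter> closure W \<noteq> {}" using D n(2) by auto
    show "D n \<inter> J2 \<noteq> {}" by (rule n(3))
  qed (use V W VW in \<open>auto simp: Int_commute\<close>)
  moreover have "S = S1 \<union> S2" using touch by (auto simp: S1_def S2_def)
  ultimately show False using infS by simp
qed

section \<open>Hausdorff limits and concentric circles\<close>

lemma hausdorff_convergent_subsequence:
  fixes P :: "nat \<Rightarrow> 'a::euclidean_space set"
  assumes A: "compact A" and P: "\<And>n. closed (P n)" "\<And>n. P n \<noteq> {}" "\<And>n. P n \<subseteq> A"
  obtains k L where "strict_mono (k :: nat \<Rightarrow> nat)" "compact L" "L \<subseteq> A" "hausdorff_converges (P \<circ> k) L"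
proof -
  have att: "\<exists>a\<in>P n. infdist x (P n) = dist x a" for n x
    using infdist_attains_inf[OF P(1,2)] by metis
  have b: "norm (infdist x (P n)) \<le> diameter A" if x: "x \<in> A" for n x
  proof -
    obtain p where p: "p \<in> P n" using P(2) by blast
    then have "dist x p \<le> diameter A"
      using x P(3) A by (intro diameter_bounded_bound) (auto intro: compact_imp_bounded)
    then show ?thesis using infdist_le[OF p, of x] by (simp add: infdist_nonneg)
  qed
  have lip: "norm (infdist x (P n) - infdist y (P n)) \<le> norm (x - y)" for x y n
    using infdist_triangle[of x "P n" y] infdist_triangle[of y "P n" x]
    by (simp add: dist_norm norm_minus_commute abs_le_iff)
  \<comment> \<open>The Arzela-Ascoli theorem is applied to the distance functions of the
    \<open>P n\<close>, which are 1-Lipschitz and bounded by the diameter of \<open>A\<close>. The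
    limit set is then the zero set of the limit function.\<close>
  obtain g k where g: "continuous_on A g" and k: "strict_mono (k :: nat \<Rightarrow> nat)"
    and gk: "\<And>e. 0 < e \<Longrightarrow> \<exists>N. \<forall>n x. n \<ge> N \<and> x \<in> A \<longrightarrow> norm (infdist x (P (k n)) - g x) < e"
  proof (rule Arzela_Ascoli[of A "\<lambda>n x. infdist x (P n)" "diameter A"])
    show "compact A" by (rule A)
    show "norm (infdist x (P n)) \<le> diameter A" if "x \<in> A" for n x using b[OF that] .
    show "\<exists>d. 0 < d \<and> (\<forall>n y. y \<in> A \<and> norm (x - y) < d \<longrightarrow> norm (infdist x (P n) - infdist y (P n)) < e)"
      if "x \<in> A" "0 < e" for x e
      using that(2) le_less_trans[OF lip] by (intro exI[of _ e]) auto
  qed (rule that)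
  define L where "L = {x \<in> A. g x = 0}"
  have kL: "compact L"
  proof -
    have "closed (A \<inter> g -` {0})"
      using g A by (intro continuous_closed_preimage) (auto intro: compact_imp_closed)
    moreover have "L = A \<inter> (A \<inter> g -` {0})" by (auto simp: L_def)
    ultimately show ?thesis using A by (metis compact_Int_closed)
  qed
  \<comment> \<open>Points of \<open>P (k n)\<close> nearest to \<open>x\<close> accumulate at a
    zero of \<open>g\<close> at distance \<open>g x\<close> from \<open>x\<close>. This gives the
    half of Hausdorff convergence that places \<open>P (k n)\<close> near \<open>L\<close>.\<close>
  have near: "\<exists>b\<in>L. dist x b = g x" if x: "x \<in> A" for x
  proof -
    have "\<forall>n. \<exists>a. a \<in> P (k n) \<and> infdist x (P (k n)) = dist x a" using att by blast
    from choice[OF this] obtain p where p: "\<And>n. p n \<in> P (k n)" "\<And>n. infdist x (P (k n)) = dist x (p n)" by blast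
    have "\<forall>n. p n \<in> A" using p(1) P(3) by blast
    then obtain l r where lr: "l \<in> A" "strict_mono (r :: nat \<Rightarrow> nat)" "(p \<circ> r) \<longlonglongrightarrow> l"
      using A[unfolded compact_def] by blast
    have pA: "(p \<circ> r) n \<in> A" for n using p(1) P(3) by auto
    \<comment> \<open>Uniform convergence permits moving arguments: the constant \<open>x\<close>
      yields the distance to the limit point, and the nearest points, where the distance function
      vanishes, show that \<open>g\<close> vanishes there.\<close>
    have lim: "(\<lambda>n. infdist (z n) (P (k (r n))) - g (z n)) \<longlonglongrightarrow> 0" if z: "\<And>n. z n \<in> A" for z
    proof (rule LIMSEQ_I)
      fix e :: real assume "0 < e"
      then obtain N where N: "\<And>n x. n \<ge> N \<Longrightarrow> x \<in> A \<Longrightarrow> norm (infdist x (P (k n)) - g x) < e"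
        using gk by blast
      have "norm (infdist (z n) (P (k (r n))) - g (z n) - 0) < e" if "n \<ge> N" for n
        using N[of "r n" "z n"] z that seq_suble[OF lr(2), of n] by simp
      then show "\<exists>no. \<forall>n\<ge>no. norm (infdist (z n) (P (k (r n))) - g (z n) - 0) < e" by blast
    qed
    have "(\<lambda>n. dist x ((p \<circ> r) n) - g x) \<longlonglongrightarrow> 0" using lim[of "\<lambda>_. x"] x p(2) by simp
    moreover have "(\<lambda>n. dist x ((p \<circ> r) n) - g x) \<longlonglongrightarrow> dist x l - g x"
      by (intro tendsto_intros lr(3))
    ultimately have xl: "dist x l = g x" using LIMSEQ_unique by fastforce
    have "(\<lambda>n. 0 - g ((p \<circ> r) n)) \<longlonglongrightarrow> 0" using lim[of "p \<circ> r"] pA p(1) by simp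
    then have g0: "(\<lambda>n. g ((p \<circ> r) n)) \<longlonglongrightarrow> 0" using tendsto_minus by fastforce
    have gl: "(\<lambda>n. g ((p \<circ> r) n)) \<longlonglongrightarrow> g l"
      using continuous_on_tendsto_compose[OF g lr(3) lr(1)] pA by auto
    have "g l = 0" using LIMSEQ_unique[OF gl g0] .
    then show ?thesis using xl lr(1) by (auto simp: L_def)
  qed
  have "hausdorff_converges (P \<circ> k) L"
    unfolding hausdorff_converges_def
  proof (intro allI impI)
    fix e :: real assume "0 < e"
    then obtain N where N: "\<And>n x. n \<ge> N \<Longrightarrow> x \<in> A \<Longrightarrow> norm (infdist x (P (k n)) - g x) < e"
      using gk by blast
    have 1: "\<exists>b\<in>L. dist a b < e" if n: "n \<ge> N" "a \<in> P (k n)" for n a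
    proof -
      have a: "a \<in> A" using n P(3) by blast
      then have "g a < e" using N[OF n(1) a] n(2) by simp
      then show ?thesis using near[OF a] by metis
    qed
    have 2: "\<exists>a\<in>P (k n). dist a b < e" if n: "n \<ge> N" "b \<in> L" for n b
    proof -
      have "infdist b (P (k n)) < e" using N[OF n(1), of b] n(2) by (simp add: L_def)
      then show ?thesis using att[of "k n" b] by (metis dist_commute)
    qed
    show "\<forall>\<^sub>F n in sequentially. (\<forall>a\<in>(P \<circ> k) n. \<exists>b\<in>L. dist a b < e) \<and> (\<forall>b\<in>L. \<exists>a\<in>(P \<circ> k) n. dist a b < e)"
      unfolding eventually_sequentially using 1 2 by (intro exI[of _ N]) auto
  qed
  then show ?thesis using that[OF k kL] by (auto simp: L_def)
qed

lemma hausdorff_limit_meets: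
  fixes P :: "nat \<Rightarrow> 'a::heine_borel set"
  assumes "hausdorff_converges P L" "compact L" "closed J" "\<And>n. P n \<inter> J \<noteq> {}"
  shows "L \<inter> J \<noteq> {}"
proof
  assume "L \<inter> J = {}"
  then obtain d where d: "d > 0" "\<And>x y. x \<in> L \<Longrightarrow> y \<in> J \<Longrightarrow> d \<le> dist x y"
    using separate_compact_closed[OF assms(2,3)] by blast
  then have "eventually (\<lambda>n. (\<forall>a\<in>P n. \<exists>b\<in>L. dist a b < d) \<and> (\<forall>b\<in>L. \<exists>a\<in>P n. dist a b < d)) sequentially"
    using assms(1) unfolding hausdorff_converges_def by blast
  then obtain n where n: "\<forall>a\<in>P n. \<exists>b\<in>L. dist a b < d"
    unfolding eventually_sequentially by blast
  obtain a where a: "a \<in> P n" "a \<in> J" using assms(4) by blast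
  then obtain b where "b \<in> L" "dist a b < d" using n by blast
  then show False using d(2)[of b a] a by (simp add: dist_commute)
qed

lemma closure_annulus:
  fixes a :: "'a::euclidean_space"
  assumes "0 < r" "r < R"
  shows "closure {z. r < norm (z - a) \<and> norm (z - a) < R} = {z. r \<le> norm (z - a) \<and> norm (z - a) \<le> R}"
    (is "closure ?A = ?B")
proof
  have "closed {z. r \<le> norm (z - a)}" "closed {z. norm (z - a) \<le> R}"
    by (intro closed_Collect_le continuous_intros)+
  then have "closed ?B" by (simp add: closed_Collect_conj)
  then show "closure ?A \<subseteq> ?B" by (intro closure_minimal) auto
  show "?B \<subseteq> closure ?A"
  proof
    fix w assume w: "w \<in> ?B"
    define \<rho> where "\<rho> = norm (w - a)"
    have \<rho>: "r \<le> \<rho>" "\<rho> \<le> R" using w by (auto simp: \<rho>_def)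
    \<comment> \<open>The radial projection of \<open>w\<close> to the middle radius;
      \<open>0 < r\<close> ensures that \<open>w\<close> is not the centre. Along the open segment
      the radius is a proper average with the middle one.\<close>
    define m where "m = a + ((r + R) / 2 / \<rho>) *\<^sub>R (w - a)"
    have nm: "norm (m - a) = (r + R) / 2" using \<rho> assms by (simp add: m_def \<rho>_def[symmetric])
    show "w \<in> closure ?A"
    proof (cases "w = m")
      case True
      then have "w \<in> ?A" using nm assms by auto
      then show ?thesis by (rule subsetD[OF closure_subset])
    next
      case False
      have "open_segment w m \<subseteq> ?A"
      proof
        fix z assume "z \<in> open_segment w m"
        then obtain u where u: "0 < u" "u < 1" "z = (1 - u) *\<^sub>R w + u *\<^sub>R m"
          by (auto simp: in_segment)
        have c: "0 \<le> (1 - u) + u * ((r + R) / 2 / \<rho>)" using u \<rho> assms by simp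
        have "z - a = (1 - u) *\<^sub>R (w - a) + u *\<^sub>R (m - a)"
          unfolding u(3) by (simp add: algebra_simps)
        also have "\<dots> = ((1 - u) + u * ((r + R) / 2 / \<rho>)) *\<^sub>R (w - a)"
          by (simp add: m_def scaleR_add_left)
        finally have "norm (z - a) = ((1 - u) + u * ((r + R) / 2 / \<rho>)) * \<rho>"
          using c by (simp add: \<rho>_def)
        also have "\<dots> = (1 - u) * \<rho> + u * ((r + R) / 2)"
          using \<rho> assms by (simp add: distrib_right)
        finally have n: "norm (z - a) = (1 - u) * \<rho> + u * ((r + R) / 2)" .
        have "(1 - u) * r \<le> (1 - u) * \<rho>" "(1 - u) * \<rho> \<le> (1 - u) * R"
          using u \<rho> by (auto intro: mult_left_mono)
        moreover have "u * r < u * ((r + R) / 2)" "u * ((r + R) / 2) < u * R"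
          using u assms by (auto intro!: mult_strict_left_mono)
        moreover have "r = (1 - u) * r + u * r" "R = (1 - u) * R + u * R" by (simp_all add: algebra_simps)
        ultimately have "r < norm (z - a)" "norm (z - a) < R"
          unfolding n by linarith+
        then show "z \<in> ?A" by simp
      qed
      then have "closure (open_segment w m) \<subseteq> closure ?A" by (rule closure_mono)
      moreover have "w \<in> closure (open_segment w m)" using False by (simp add: closure_open_segment)
      ultimately show ?thesis by blast
    qed
  qed
qed

text \<open>With \<open>y\<close> as the point at infinity, both curves are concentric circles in
  one chart. The part of \<open>K\<close> in the closed annulus is what is left after removing the
  inner disc and the outer region, so the crossing components forced by \<open>S_set\<close> are
  candidates for the relation.\<close>

lemma schoenflies_rel_near:
  assumes K: "compact K" "K \<subseteq> Chat" and x: "x \<in> K" and y: "y \<in> S_set K x" and xy: "x \<noteq> y" and e: "0 < e"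
  shows "\<exists>x' y'. (x', y') \<in> schoenflies_rel K \<and> dist x' x < e \<and> dist y' y < e"
proof -
  have yK: "y \<in> K" using y by (simp add: S_set_def)
  have yC: "y \<in> Chat" and xC: "x \<in> Chat - {y}" using x yK K xy by auto
  have cpC: "compact Chat" by (simp add: Chat_def)
  obtain f g where hom: "homeomorphism (Chat - {y}) (UNIV :: complex set) f g"
    using punctured_Chat_homeomorphism[OF yC] .
  have contf: "continuous_on (Chat - {y}) f" and contg: "continuous_on UNIV g"
    and gf: "\<And>z. z \<in> Chat - {y} \<Longrightarrow> g (f z) = z" and fg: "\<And>z. f (g z) = z"
    and gC: "\<And>z. g z \<in> Chat - {y}"
    using hom by (auto simp: homeomorphism_def)
  have cg: "continuous_on S g" for S using contg continuous_on_subset by blast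
  have injg: "inj g" using fg by (metis injI)
  define a where "a = f x"
  have ga: "g a = x" using gf xC by (simp add: a_def)
  obtain r where r: "r > 0" "g ` cball a r \<subseteq> ball x e"
  proof -
    have "open (g -` ball x e)" using contg open_ball by (metis continuous_on_open_vimage open_UNIV Int_UNIV_right)
    then obtain r where "r > 0" "cball a r \<subseteq> g -` ball x e"
      using ga e by (metis open_contains_cball vimageI centre_in_ball)
    then show ?thesis using that by blast
  qed
  \<comment> \<open>\<open>R\<close> exceeds the image radius of every point at distance at least
    \<open>e\<close> from \<open>y\<close>, so the circle of radius \<open>R\<close> comes from
    within \<open>e\<close> of \<open>y\<close>.\<close>
  obtain R where R: "r < R" "\<And>z. z \<in> Chat \<Longrightarrow> dist z y \<ge> e \<Longrightarrow> dist a (f z) < R"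
  proof -
    have sub: "Chat - ball y e \<subseteq> Chat - {y}" using e by auto
    have "compact (f ` (Chat - ball y e))"
      using cpC continuous_on_subset[OF contf sub] by (intro compact_continuous_image compact_diff) auto
    then obtain R0 where R0: "\<forall>w \<in> f ` (Chat - ball y e). dist a w \<le> R0"
      using compact_imp_bounded bounded_any_center by blast
    show ?thesis
    proof (rule that[of "max R0 r + 1"])
      show "dist a (f z) < max R0 r + 1" if "z \<in> Chat" "dist z y \<ge> e" for z
        using R0[rule_format, of "f z"] that by (fastforce simp: dist_commute)
    qed simp
  qed
  have R0: "0 < R" using r R by simp
  define An where "An = {z. r < norm (z - a) \<and> norm (z - a) < R}"
  define cAn where "cAn = {z. r \<le> norm (z - a) \<and> norm (z - a) \<le> R}"
  define J1 where "J1 = g ` sphere a r"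
  define J2 where "J2 = g ` sphere a R"
  define U where "U = g ` An"
  have clAn: "closure An = cAn" unfolding An_def cAn_def by (rule closure_annulus[OF r(1) R(1)])
  have bAn: "bounded An" by (rule bounded_subset[of "cball a R"]) (auto simp: An_def dist_norm norm_minus_commute)
  have kcAn: "compact cAn" unfolding clAn[symmetric] using bAn by simp
  have clU: "closure U = g ` cAn"
  proof
    show "closure U \<subseteq> g ` cAn"
      using kcAn cg closure_subset[of An] clAn unfolding U_def
      by (intro closure_minimal compact_imp_closed compact_continuous_image image_mono) auto
    show "g ` cAn \<subseteq> closure U"
      unfolding U_def clAn[symmetric] using cg by (intro image_closure_subset) (auto simp: closure_subset)
  qed
  have scc: "simple_closed_curve (g ` sphere a s)" if "s > 0" for s
  proof -
    have "homeomorphism (sphere a s) (g ` sphere a s) g f"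
      using homeomorphism_of_subsets[OF homeomorphism_symD[OF hom]] gC by blast
    then have "(g ` sphere a s) homeomorphic sphere a s" using homeomorphic_def homeomorphic_sym by blast
    then have "(g ` sphere a s) homeomorphic sphere (0::complex) 1"
      using homeomorphic_trans homeomorphic_spheres[OF that zero_less_one] by blast
    then show ?thesis using gC by (auto simp: simple_closed_curve_def)
  qed
  have sccJ: "simple_closed_curve J1" "simple_closed_curve J2" using scc r(1) R0 by (auto simp: J1_def J2_def)
  have gI: "g ` S \<inter> g ` S' = g ` (S \<inter> S')" for S S' using injg by (simp add: image_Int)
  have JJ: "J1 \<inter> J2 = {}" using R(1) unfolding J1_def J2_def gI by (auto simp: sphere_def)
  have UJ: "U \<inter> (J1 \<union> J2) = {}" "closure U = U \<union> (J1 \<union> J2)"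
  proof -
    have "An \<inter> (sphere a r \<union> sphere a R) = {}" by (auto simp: An_def dist_norm norm_minus_commute)
    then show "U \<inter> (J1 \<union> J2) = {}" unfolding U_def J1_def J2_def image_Un[symmetric] gI by simp
    have "cAn = An \<union> (sphere a r \<union> sphere a R)"
      using R(1) by (auto simp: An_def cAn_def dist_norm norm_minus_commute)
    then have "g ` cAn = U \<union> (J1 \<union> J2)" unfolding U_def J1_def J2_def by (simp only: image_Un)
    then show "closure U = U \<union> (J1 \<union> J2)" using clU by simp
  qed
  have UC: "U \<subseteq> Chat" using gC by (auto simp: U_def)
  have oAn: "open An"
    unfolding An_def by (intro open_Collect_conj open_Collect_less continuous_intros)
  have oU: "openin (top_of_set Chat) U" unfolding U_def by (rule open_image_Chat[OF hom oAn])
  have frU: "(top_of_set Chat) frontier_of U = J1 \<union> J2"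
  proof -
    have "closure U \<subseteq> Chat" using cpC UC by (simp add: closure_minimal compact_imp_closed)
    then have "(top_of_set Chat) frontier_of U = closure U - U"
      using oU UC unfolding frontier_of_def
      by (simp add: interior_of_openin closure_of_subtopology Int_absorb1 Int_absorb2)
    then show ?thesis using UJ by blast
  qed
  have Une: "U \<noteq> {}"
  proof -
    have "closure U \<noteq> {}" using UJ(2) simple_closed_curve_nonempty[OF sccJ(1)] by simp
    then show ?thesis by auto
  qed
  have cU: "connected U"
    unfolding U_def An_def using cg by (intro connected_continuous_image connected_annulus) auto
  have Ucomp: "U \<in> components (Chat - (J1 \<union> J2))"
    unfolding in_components_maximal
  proof (intro conjI allI impI)
    fix D assume D: "D \<noteq> {} \<and> U \<subseteq> D \<and> D \<subseteq> Chat - (J1 \<union> J2) \<and> connected D"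
    have "Chat \<inter> U = U" using UC by blast
    then have "openin (top_of_set D) (D \<inter> U)"
      using openin_subtopology_Int_subset[of Chat U D] oU D by auto
    moreover have "D \<inter> U = D \<inter> closure U" using D UJ by blast
    then have "closedin (top_of_set D) (D \<inter> U)" by (simp add: closedin_closed_Int)
    ultimately have "D \<inter> U = {} \<or> D \<inter> U = D"
      using connected_clopen[THEN iffD1, of D, rule_format, of "D \<inter> U"] D by blast
    then show "D = U" using D Une by blast
  qed (use Une UC UJ cU in auto)
  define Ux where "Ux = K \<inter> g ` ball a r"
  \<comment> \<open>A complement is used because \<open>y\<close> itself is outside the range of
    \<open>g\<close>.\<close>
  define Uy where "Uy = K - g ` cball a R"
  have kg: "compact (g ` cball a s)" for s using cg by (intro compact_continuous_image) auto
  have opg: "openin (top_of_set K) (K \<inter> g ` ball a s)" for s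
  proof -
    have "Chat \<inter> g ` ball a s = g ` ball a s" using gC by blast
    then show ?thesis
      using openin_subtopology_Int_subset[of Chat "g ` ball a s" K] open_image_Chat[OF hom open_ball] K(2) by auto
  qed
  have oUx: "openin (top_of_set K) Ux" unfolding Ux_def by (rule opg)
  have oUy: "openin (top_of_set K) Uy"
    unfolding Uy_def Diff_eq using kg by (simp add: openin_open_Int open_Compl compact_imp_closed)
  have xUx: "x \<in> Ux" using x ga r(1) by (auto simp: Ux_def)
  have yUy: "y \<in> Uy" using yK gC by (auto simp: Uy_def)
  have "ball a r \<subseteq> cball a R" using R by (auto simp: subset_eq)
  then have dU: "Ux \<inter> Uy = {}" by (auto simp: Ux_def Uy_def)
  define T where "T = {C \<in> components (K - (Ux \<union> Uy)).
                C \<inter> ((top_of_set K) frontier_of Ux) \<noteq> {} \<and> C \<inter> ((top_of_set K) frontier_of Uy) \<noteq> {}}"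
  have "infinite T"
    using y oUx oUy dU xUx yUy unfolding S_set_def T_def by blast
  then obtain P0 :: "nat \<Rightarrow> (real^3) set" where P0: "inj P0" "range P0 \<subseteq> T"
    using infinite_countable_subset by blast
  have gset: "g w \<in> g ` S \<longleftrightarrow> w \<in> S" for w S using injg by (simp add: inj_image_mem_iff)
  have Kg: "\<exists>w. z = g w" if "z \<in> K" "z \<noteq> y" for z
    using that gf K(2) by (metis Diff_iff empty_iff insert_iff subsetD)
  have AK: "closure U \<inter> K = K - (Ux \<union> Uy)"
  proof -
    have "z \<in> closure U \<longleftrightarrow> z \<notin> Ux \<union> Uy" if zK: "z \<in> K" for z
    proof (cases "z = y")
      case True
      then show ?thesis using yUy gC clU by auto
    next
      case False
      then obtain w where w: "z = g w" using Kg zK by blast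
      show ?thesis using zK unfolding w clU Ux_def Uy_def
        by (auto simp: gset cAn_def dist_norm norm_minus_commute)
    qed
    then show ?thesis by (auto simp: Ux_def Uy_def)
  qed
  have fr: "(top_of_set K) frontier_of S = K \<inter> closure S - S" if "openin (top_of_set K) S" for S
    using that openin_imp_subset[OF that] unfolding frontier_of_def
    by (simp add: interior_of_openin closure_of_subtopology Int_absorb1 Int_absorb2)
  have fr1: "(top_of_set K) frontier_of Ux \<subseteq> J1"
  proof
    fix z assume "z \<in> (top_of_set K) frontier_of Ux"
    then have z: "z \<in> K" "z \<in> closure Ux" "z \<notin> Ux" using fr[OF oUx] by auto
    have "closure Ux \<subseteq> g ` cball a r"
      using kg by (intro closure_minimal compact_imp_closed) (auto simp: Ux_def)
    then obtain w where w: "z = g w" "w \<in> cball a r" using z by blast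
    then have "w \<notin> ball a r" using z by (auto simp: Ux_def)
    then show "z \<in> J1" using w by (auto simp: J1_def)
  qed
  have fr2: "(top_of_set K) frontier_of Uy \<subseteq> J2"
  proof
    fix z assume "z \<in> (top_of_set K) frontier_of Uy"
    then have z: "z \<in> K" "z \<in> closure Uy" "z \<notin> Uy" using fr[OF oUy] by auto
    then obtain w where w: "z = g w" "w \<in> cball a R" by (auto simp: Uy_def)
    have "w \<notin> ball a R"
    proof
      assume "w \<in> ball a R"
      then have "z \<in> K \<inter> g ` ball a R" using w z by auto
      moreover have "(K \<inter> g ` ball a R) \<inter> Uy = {}" using ball_subset_cball by (auto simp: Uy_def)
      moreover obtain Q where "open Q" "K \<inter> g ` ball a R = K \<inter> Q" using opg by (auto simp: openin_open)
      moreover have "Uy \<subseteq> K" by (auto simp: Uy_def)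
      ultimately show False using z(2) open_Int_closure_eq_empty[of Q Uy] by blast
    qed
    then show "z \<in> J2" using w by (auto simp: J2_def)
  qed
  have kAK: "compact (closure U \<inter> K)" using K by (simp add: closed_Int_compact)
  have P1: "P0 n \<in> components (closure U \<inter> K)" "P0 n \<inter> J1 \<noteq> {}" "P0 n \<inter> J2 \<noteq> {}" for n
    using P0(2) fr1 fr2 unfolding T_def AK by blast+
  have P2: "closed (P0 n)" "P0 n \<noteq> {}" "P0 n \<subseteq> closure U \<inter> K" for n
    using P1[of n] compact_components[OF kAK] in_components_nonempty in_components_subset compact_imp_closed
    by blast+
  obtain k L where kL: "strict_mono (k :: nat \<Rightarrow> nat)" "compact L" "L \<subseteq> closure U \<inter> K"
     "hausdorff_converges (P0 \<circ> k) L"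
    by (rule hausdorff_convergent_subsequence[OF kAK P2])
  have clJ: "closed J1" "closed J2"
    using sccJ by (simp_all add: simple_closed_curve_compact compact_imp_closed)
  \<comment> \<open>The limit need not contain \<open>x\<close> or \<open>y\<close>, only points of
    the two circles; this is why the pair is merely approximated by the relation.\<close>
  obtain x' where x': "x' \<in> L" "x' \<in> J1"
    using hausdorff_limit_meets[OF kL(4,2) clJ(1)] P1 by auto
  obtain y' where y': "y' \<in> L" "y' \<in> J2"
    using hausdorff_limit_meets[OF kL(4,2) clJ(2)] P1 by auto
  have "inj (P0 \<circ> k)" using P0(1) kL(1) strict_mono_imp_inj_on by (metis inj_compose)
  moreover have "\<forall>n. (P0 \<circ> k) n \<in> components (closure U \<inter> K) \<and> (P0 \<circ> k) n \<inter> J1 \<noteq> {} \<and> (P0 \<circ> k) n \<inter> J2 \<noteq> {}"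
    using P1 by simp
  moreover have "x' \<in> K" "y' \<in> K" "x' \<noteq> y'" "{x', y'} \<subseteq> L" using x' y' kL(3) JJ by auto
  ultimately have "(x', y') \<in> schoenflies_rel K"
    using sccJ JJ x'(2) y'(2) Ucomp frU kL(2,4) unfolding schoenflies_rel_def by blast
  moreover have "dist x' x < e"
  proof -
    have "J1 \<subseteq> g ` cball a r" unfolding J1_def by (intro image_mono sphere_cball)
    then show ?thesis using x' r(2) by (metis dist_commute mem_ball subsetD)
  qed
  moreover have "dist y' y < e"
  proof (rule ccontr)
    assume "\<not> dist y' y < e"
    moreover obtain w where w: "y' = g w" "dist a w = R" using y' by (auto simp: J2_def)
    ultimately have "dist a (f y') < R" using R(2)[of y'] gC by auto
    then show False using w fg by simp
  qed
  ultimately show ?thesis by blast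
qed

section \<open>The two inclusions\<close>

theorem theorem4p3:
  fixes K :: "(real^3) set"
  assumes "compact K" and "K \<subseteq> Chat"
  shows "\<forall>x\<in>K. S_set K x = {y. (x, y) \<in> closure (schoenflies_rel K)}"
proof (intro ballI equalityI subsetI)
  fix x y assume x: "x \<in> K" and y: "y \<in> S_set K x"
  have "(x, y) \<in> closure (schoenflies_rel K)"
  proof (cases "x = y")
    case True
    then have "(x, y) \<in> schoenflies_rel K" using x by (simp add: schoenflies_rel_def)
    then show ?thesis by (rule subsetD[OF closure_subset])
  next
    case False
    show ?thesis
      unfolding closure_approachable
    proof (intro allI impI)
      fix e :: real assume "0 < e"
      then obtain x' y' where xy: "(x', y') \<in> schoenflies_rel K" "dist x' x < e/2" "dist y' y < e/2"
        using schoenflies_rel_near[OF assms x y False, of "e/2"] by auto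
      have "dist (x', y') (x, y) \<le> dist x' x + dist y' y"
        unfolding dist_Pair_Pair by (rule sqrt_sum_squares_le_sum) auto
      then have "dist (x', y') (x, y) < e" using xy(2,3) by linarith
      then show "\<exists>p\<in>schoenflies_rel K. dist p (x, y) < e" using xy(1) by blast
    qed
  qed
  then show "y \<in> {y. (x, y) \<in> closure (schoenflies_rel K)}" by simp
next
  fix x y assume x: "x \<in> K" and "y \<in> {y. (x, y) \<in> closure (schoenflies_rel K)}"
  then have cl: "(x, y) \<in> closure (schoenflies_rel K)" by simp
  have "closure (schoenflies_rel K) \<subseteq> K \<times> K"
    using assms(1) by (intro closure_minimal closed_Times) (auto simp: schoenflies_rel_def compact_imp_closed)
  then have yK: "y \<in> K" using cl by blast
  have False
    if U: "openin (top_of_set K) Ux" "openin (top_of_set K) Uy" "Ux \<inter> Uy = {}" "x \<in> Ux" "y \<in> Uy"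
      and fin: "finite {C \<in> components (K - (Ux \<union> Uy)).
                C \<inter> ((top_of_set K) frontier_of Ux) \<noteq> {} \<and>
                C \<inter> ((top_of_set K) frontier_of Uy) \<noteq> {}}" for Ux Uy
  proof -
    obtain Ox where Ox: "open Ox" "Ux = K \<inter> Ox" using U(1) by (auto simp: openin_open)
    obtain Oy where Oy: "open Oy" "Uy = K \<inter> Oy" using U(2) by (auto simp: openin_open)
    \<comment> \<open>The separating sets serve all nearby pairs as well, so the limit pair can be
      replaced by a pair of the relation itself; disjointness of \<open>Ux\<close> and
      \<open>Uy\<close> puts that pair off the diagonal.\<close>
    have "open (Ox \<times> Oy)" using Ox(1) Oy(1) by (rule open_Times)
    moreover have "(x, y) \<in> Ox \<times> Oy" using U Ox Oy by auto
    ultimately obtain x' y' where xy: "(x', y') \<in> schoenflies_rel K" "x' \<in> Ox" "y' \<in> Oy"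
      using cl unfolding closure_iff_nhds_not_empty by blast
    then have xyU: "x' \<in> Ux" "y' \<in> Uy" using Ox Oy by (auto simp: schoenflies_rel_def)
    then have "x' \<noteq> y'" using U(3) by auto
    then obtain J1 J2 U0 and P :: "nat \<Rightarrow> (real^3) set" and L where J: "simple_closed_curve J1" "simple_closed_curve J2"
        "J1 \<inter> J2 = {}" "x' \<in> J1" "y' \<in> J2" "U0 \<in> components (Chat - (J1 \<union> J2))"
        "(top_of_set Chat) frontier_of U0 = J1 \<union> J2" "inj P"
        "\<And>n. P n \<in> components (closure U0 \<inter> K)" "hausdorff_converges P L" "x' \<in> L" "y' \<in> L"
      using xy(1) unfolding schoenflies_rel_def by auto
    show False
      using infinite_crossing_components[OF assms J(1,4,2,5,3,6-12) U(1) xyU(1) U(2) xyU(2) U(3)] fin by blast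
  qed
  then show "y \<in> S_set K x" unfolding S_set_def using yK by blast
qed

end
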